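(* Let $p\ge0$ be an integer, let $q\in C^p[-b,b]$ be complex valued, let $f$ be a solution of $f''=qf$ on $[-b,b]$ with $f\neq0$ on $[-b,b]$, $f(0)=1$, and $h:=f'(0)$, and let $\mathbf{K}$ be the transmutation kernel associated with $q$ and $h$. Then there exist a constant $\widetilde c_p$ and a sequence of approximate kernels $K_N$, $N\in\mathbb{N}$, of the form $$K_N(x,t)=a_0u_0(x,t)+\sum_{n=1}^Na_nu_{2n-1}(x,t)+\sum_{n=1}^Nb_nu_{2n}(x,t)$$ (with complex coefficients $a_0,\ldots,a_N,b_1,\ldots,b_N$ which may depend on $N$) such that $$\max_{(x,t)\in\overline{\mathbf{S}}}\bigl|\mathbf{K}(x,t)-K_N(x,t)\bigr|\le\frac{\widetilde c_p}{N^{p+1}}.$$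
   Context: $\overline{\mathbf{S}}=[-b,b]\times[-b,b]$. Kernel: $\mathbf{K}(x,t)=\mathbf{H}\big(\frac{x+t}{2},\frac{x-t}{2}\big)$ on $\overline{\mathbf{S}}$, where $\mathbf{H}$ is the unique solution of $\frac{\partial^2\mathbf{H}(u,v)}{\partial u\,\partial v}=q(u+v)\mathbf{H}(u,v)$, $\mathbf{H}(u,0)=\frac h2+\frac12\int_0^u q(s)\,ds$, $\mathbf{H}(0,v)=\frac h2$ (equivalently $\mathbf{H}(u,v)=\frac h2+\frac12\int_0^u q(s)\,ds+\int_0^u\int_0^v q(\alpha+\beta)\mathbf{H}(\alpha,\beta)\,d\beta\,d\alpha$). Functions $\varphi_k$ on $[-b,b]$: $X^{(0)}\equiv\widetilde X^{(0)}\equiv1$, $X^{(n)}(x)=n\int_0^x X^{(n-1)}(s)\left(f^2(s)\right)^{(-1)^n}ds$, $\widetilde X^{(n)}(x)=n\int_0^x \widetilde X^{(n-1)}(s)\left(f^2(s)\right)^{(-1)^{n-1}}ds$ for $n\ge1$; $\varphi_k=fX^{(k)}$ for $k$ odd, $\varphi_k=f\widetilde X^{(k)}$ for $k$ even. Generalized wave polynomials: $u_0(x,t)=\varphi_0(x)$ and, for $m\ge1$, $u_{2m-1}(x,t)=\sum_{\text{even }k=0}^m\binom mk\varphi_{m-k}(x)t^k$, $u_{2m}(x,t)=\sum_{\text{odd }k=1}^m\binom mk\varphi_{m-k}(x)t^k$. *)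

theory Defs
  imports "HOL-Analysis.Analysis"
begin

text \<open>
  The class \<open>C\<^sup>k(S)\<close> for functions of a real variable. Derivatives are taken within \<open>S\<close>,
  i.e. they are one-sided at the endpoints when \<open>S\<close> is a compact interval.
\<close>
primrec Ck_on :: "nat \<Rightarrow> (real \<Rightarrow> complex) \<Rightarrow> real set \<Rightarrow> bool" where
  "Ck_on 0 g S \<longleftrightarrow> continuous_on S g"
| "Ck_on (Suc k) g S \<longleftrightarrow>
     (\<exists>g'. (\<forall>x\<in>S. (g has_vector_derivative g' x) (at x within S)) \<and> Ck_on k g' S)"

text \<open>
  The interval integral \<open>LBINT s=0..x\<close> is oriented, so these definitions
  are meaningful for \<open>x < 0\<close> as well.
\<close>
primrec Xf :: "(real \<Rightarrow> complex) \<Rightarrow> nat \<Rightarrow> real \<Rightarrow> complex" where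
  "Xf f 0 x = 1"
| "Xf f (Suc n) x =
     of_nat (Suc n) * (LBINT s=0..x. Xf f n s * ((f s)\<^sup>2) powi ((- 1) ^ Suc n))"

primrec Xt :: "(real \<Rightarrow> complex) \<Rightarrow> nat \<Rightarrow> real \<Rightarrow> complex" where
  "Xt f 0 x = 1"
| "Xt f (Suc n) x =
     of_nat (Suc n) * (LBINT s=0..x. Xt f n s * ((f s)\<^sup>2) powi ((- 1) ^ n))"

definition phi :: "(real \<Rightarrow> complex) \<Rightarrow> nat \<Rightarrow> real \<Rightarrow> complex" where
  "phi f k x = f x * (if odd k then Xf f k x else Xt f k x)"

text \<open>
  Generalized wave polynomials \<open>u\<^sub>n\<close>. Both for \<open>n = 2 * m - 1\<close> and for \<open>n = 2 * m\<close>
  (with \<open>m \<ge> 1\<close>) one has \<open>m = (n + 1) div 2\<close>.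
\<close>
definition wave_poly :: "(real \<Rightarrow> complex) \<Rightarrow> nat \<Rightarrow> real \<Rightarrow> real \<Rightarrow> complex" where
  "wave_poly f n x t =
     (if n = 0 then phi f 0 x
      else let m = (n + 1) div 2 in
        if odd n
        then \<Sum>k | k \<le> m \<and> even k. of_nat (m choose k) * phi f (m - k) x * of_real t ^ k
        else \<Sum>k | k \<le> m \<and> odd k. of_nat (m choose k) * phi f (m - k) x * of_real t ^ k)"

text \<open>
  The \<open>(u, v)\<close>-domain corresponding to the square \<open>[-b, b] \<times> [-b, b]\<close> in the variables
  \<open>x = u + v\<close>, \<open>t = u - v\<close>; it is the set \<open>\<bar>u\<bar> + \<bar>v\<bar> \<le> b\<close>.
\<close>
definition goursat_domain :: "real \<Rightarrow> (real \<times> real) set" where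
  "goursat_domain b = {(u, v). u + v \<in> {- b..b} \<and> u - v \<in> {- b..b}}"

text \<open>
  Classical solutions of the Goursat problem: continuous on the closed domain, with the equation
  holding in its interior. Here \<open>Hv\<close> is the partial derivative of \<open>H\<close> with respect to \<open>v\<close>;
  it is differentiated with respect to \<open>u\<close>. These requirements determine \<open>H\<close> uniquely on
  the closed domain when \<open>q\<close> is continuous on \<open>[-b, b]\<close>.
\<close>
definition goursat_solution ::
    "real \<Rightarrow> (real \<Rightarrow> complex) \<Rightarrow> complex \<Rightarrow> (real \<Rightarrow> real \<Rightarrow> complex) \<Rightarrow> bool" where
  "goursat_solution b q h H \<longleftrightarrow>
     continuous_on (goursat_domain b) (\<lambda>(u, v). H u v) \<and>
     (\<exists>Hv. \<forall>(u, v) \<in> interior (goursat_domain b).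
        ((\<lambda>w. H u w) has_vector_derivative Hv u v) (at v) \<and>
        ((\<lambda>w. Hv w v) has_vector_derivative q (u + v) * H u v) (at u)) \<and>
     (\<forall>u\<in>{- b..b}. H u 0 = h / 2 + 1 / 2 * (LBINT s=0..u. q s)) \<and>
     (\<forall>v\<in>{- b..b}. H 0 v = h / 2)"

definition transmutation_kernel ::
    "real \<Rightarrow> (real \<Rightarrow> complex) \<Rightarrow> complex \<Rightarrow> (real \<Rightarrow> real \<Rightarrow> complex) \<Rightarrow> bool" where
  "transmutation_kernel b q h K \<longleftrightarrow>
     (\<exists>H. goursat_solution b q h H \<and>
       (\<forall>x\<in>{- b..b}. \<forall>t\<in>{- b..b}. K x t = H ((x + t) / 2) ((x - t) / 2)))"

end

theory Submission
  imports Defs "HOL-Computational_Algebra.Polynomial"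
begin

text \<open>
  In the characteristic coordinates u = (x + t) / 2 and v = (x - t) / 2 both the kernel and all
  generalized wave polynomials solve the same equation H_uv = q (u + v) H. The idea is to
  compare them through their Cauchy data on the line x = 0, because there the wave polynomials
  are simply polynomials. Writing W for u_(2m-1) + u_(2m) or u_(2m-1) - u_(2m), the trace of W
  on x = 0 is a monomial in t, and the quantity W_v - h W is zero in the first case and the
  derivative of a monomial in the second (\<open>signed_wave_at_0\<close>,
  \<open>signed_wave_dv_at_0\<close>). Hence every pair of polynomials of degree at most N
  arises as a pair of data (trace, integral of W_v - h W) of a combination of the wave
  polynomials up to u_(2N). The Cauchy problem is stable in the maximum norm for exactly this
  pair of data (\<open>cauchy_stability\<close>), so the error in the kernel is bounded by the
  error in two polynomial approximation problems in one variable.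

  It remains to see that the data of the kernel are of class C^(p+1); Jackson's theorem
  (\<open>Ck_on_polynomial_rate\<close>) then gives the rate N^-(p+1). Here one difficulty
  appears. To determine a solution on the square |x|, |t| \<le> b, Cauchy data on x = 0 are
  needed for |t| \<le> 2 b, but the kernel is given for |t| \<le> b only. Therefore q is
  extended to the real line as a C^p function, and the Goursat problem is solved anew on the
  larger square |u|, |v| \<le> b (\<open>goursat_smooth_solution\<close>). Its solution
  coincides with the kernel where the kernel is given (\<open>goursat_solution_eq\<close>), and
  it is of class C^(p+1) because each of its partial derivatives is an integral of q H, up to a
  multiple of q. The comparison takes place on the hexagon |u|, |v|, |u + v| \<le> b, where only
  values of q and f on [-b, b] enter.

  Jackson's theorem is proved by convolution with an algebraic kernel, the fourth power of the
  Dirichlet kernel written as a polynomial in sin t (\<open>jackson_kernel\<close>), which gives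
  the rate 1 / N for Lipschitz functions; integrating polynomial approximations of the
  derivative gains one further factor 1 / N per derivative.
\<close>

section \<open>Jackson's theorem for algebraic polynomials\<close>

lemma even_cosine_polynomial:
  "\<exists>c::real poly. degree c \<le> 2 * j \<and> (\<forall>t. poly c (sin t) = cos (real (2 * j) * t))"
proof -
  have "(\<exists>c::real poly. degree c \<le> 2 * j \<and> (\<forall>t. poly c (sin t) = cos (real (2 * j) * t))) \<and>
        (\<exists>c::real poly. degree c \<le> 2 * Suc j \<and> (\<forall>t. poly c (sin t) = cos (real (2 * Suc j) * t)))"
  proof (induction j)
    case 0
    have "degree (1::real poly) \<le> 2 * 0 \<and> (\<forall>t. poly (1::real poly) (sin t) = cos (real (2 * 0) * t))"
      by simp
    moreover have "degree [:1, 0, -2::real:] \<le> 2 * Suc 0 \<and>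
        (\<forall>t. poly [:1, 0, -2::real:] (sin t) = cos (real (2 * Suc 0) * t))"
      using cos_double_sin[where 'a = real] by (auto simp: power2_eq_square algebra_simps)
    ultimately show ?case by blast
  next
    case (Suc j)
    then obtain c d :: "real poly" where c: "degree c \<le> 2 * j" "\<And>t. poly c (sin t) = cos (real (2 * j) * t)"
      and d: "degree d \<le> 2 * Suc j" "\<And>t. poly d (sin t) = cos (real (2 * Suc j) * t)" by blast
    let ?e = "[:2, 0, -4:] * d - c"
    have "degree ([:2, 0, -4:] * d) \<le> 2 * Suc (Suc j)"
      using degree_mult_le[of "[:2, 0, -4:]" d] d(1) by simp
    then have "degree ?e \<le> 2 * Suc (Suc j)"
      using c(1) by (intro degree_diff_le) auto
    moreover have "poly ?e (sin t) = cos (real (2 * Suc (Suc j)) * t)" for t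
    proof -
      have "poly ?e (sin t) = 2 * (1 - 2 * sin t ^ 2) * cos (real (2 * Suc j) * t) - cos (real (2 * j) * t)"
        by (simp add: c d power2_eq_square algebra_simps)
      also have "\<dots> = 2 * cos (2 * t) * cos (real (2 * Suc j) * t) - cos (real (2 * j) * t)"
        by (simp only: cos_double_sin)
      also have "\<dots> = cos (real (2 * Suc j) * t + 2 * t)
          + cos (real (2 * Suc j) * t - 2 * t) - cos (real (2 * j) * t)"
        unfolding cos_add cos_diff by simp
      also have "real (2 * Suc j) * t - 2 * t = real (2 * j) * t" by (simp add: algebra_simps)
      also have "real (2 * Suc j) * t + 2 * t = real (2 * Suc (Suc j)) * t" by (simp add: algebra_simps)
      finally show ?thesis by simp
    qed
    ultimately show ?case using d by blast
  qed
  then show ?thesis by blast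
qed

lemma abs_sin_nat_mult_le: "\<bar>sin (real n * t)\<bar> \<le> real n * \<bar>sin t\<bar>"
proof (induction n)
  case (Suc n)
  have "real (Suc n) * t = real n * t + t" by (simp add: distrib_right)
  then have "\<bar>sin (real (Suc n) * t)\<bar> = \<bar>sin (real n * t) * cos t + cos (real n * t) * sin t\<bar>"
    by (simp only: sin_add)
  also have "\<dots> \<le> \<bar>sin (real n * t)\<bar> * \<bar>cos t\<bar> + \<bar>cos (real n * t)\<bar> * \<bar>sin t\<bar>"
    by (metis abs_mult abs_triangle_ineq)
  also have "\<dots> \<le> \<bar>sin (real n * t)\<bar> * 1 + 1 * \<bar>sin t\<bar>"
    by (intro add_mono mult_mono) auto
  finally show ?case using Suc.IH by (simp add: algebra_simps)
qed simp

text \<open>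
  The polynomial r is the Dirichlet kernel read in the variable x = sin t: r (sin t) = 1 + 2 *
  (\<Sum>j=1..m. cos (2 j t)), so that x * r x = sin ((2 m + 1) t). This closed form gives the
  decay 1 / |x|; the sum gives the peak, because every cosine is at least 1/2 when |x| \<le> 1 /
  (2 m).
\<close>
lemma dirichlet_polynomial:
  assumes m: "m \<ge> 1"
  obtains r :: "real poly" where "degree r \<le> 2 * m"
    and "\<And>x. x \<in> {-1..1} \<Longrightarrow> \<bar>poly r x\<bar> \<le> real (2 * m + 1)"
    and "\<And>x. x \<in> {-1..1} \<Longrightarrow> \<bar>x * poly r x\<bar> \<le> 1"
    and "\<And>x. \<bar>x\<bar> \<le> 1 / (2 * real m) \<Longrightarrow> real m \<le> poly r x"
proof -
  obtain c :: "nat \<Rightarrow> real poly" where c: "\<And>j. degree (c j) \<le> 2 * j"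
    "\<And>j t. poly (c j) (sin t) = cos (real (2 * j) * t)"
    using even_cosine_polynomial by metis
  define r where "r = 1 + smult 2 (\<Sum>j=1..m. c j)"
  have "degree (\<Sum>j=1..m. c j) \<le> 2 * m"
    using c(1) by (intro degree_sum_le) (auto intro: order_trans[OF c(1)])
  then have deg: "degree r \<le> 2 * m"
    unfolding r_def by (intro degree_add_le) auto
  have r: "poly r (sin t) = 1 + 2 * (\<Sum>j=1..m. cos (real (2 * j) * t))" for t
    by (simp add: r_def poly_sum c)
  have closed: "sin t * (1 + 2 * (\<Sum>j=1..k. cos (real (2 * j) * t))) = sin (real (2 * k + 1) * t)" for k t
  proof (induction k)
    case (Suc k)
    have "sin (real (2 * Suc k) * t + t) - sin (real (2 * Suc k) * t - t)
          = 2 * sin t * cos (real (2 * Suc k) * t)"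
      unfolding sin_add sin_diff by simp
    moreover have "real (2 * Suc k) * t + t = real (2 * Suc k + 1) * t"
      "real (2 * Suc k) * t - t = real (2 * k + 1) * t" by (simp_all add: algebra_simps)
    ultimately show ?case using Suc by (simp add: algebra_simps)
  qed simp
  have arc: "\<exists>t. x = sin t" if "x \<in> {-1..1}" for x :: real
    using that by (intro exI[of _ "arcsin x"]) simp
  show ?thesis
  proof
    show "\<bar>poly r x\<bar> \<le> real (2 * m + 1)" if x: "x \<in> {-1..1}" for x
    proof -
      obtain t where t: "x = sin t" using arc x by blast
      have "\<bar>\<Sum>j=1..m. cos (real (2 * j) * t)\<bar> \<le> (\<Sum>j=1..m. 1)"
        by (rule order_trans[OF sum_abs]) (intro sum_mono, simp)
      then show ?thesis by (simp add: t r)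
    qed
    show "\<bar>x * poly r x\<bar> \<le> 1" if x: "x \<in> {-1..1}" for x
    proof -
      obtain t where t: "x = sin t" using arc x by blast
      show ?thesis unfolding t r closed by simp
    qed
    show "real m \<le> poly r x" if x: "\<bar>x\<bar> \<le> 1 / (2 * real m)" for x
    proof -
      have "1 / (2 * real m) \<le> 1" using m by simp
      then have "x \<in> {-1..1}" using x by auto
      then obtain t where t: "x = sin t" using arc by blast
      have "1 / 2 \<le> cos (real (2 * j) * t)" if j: "j \<in> {1..m}" for j
      proof -
        have "\<bar>sin (real j * t)\<bar> \<le> real m * (1 / (2 * real m))"
          using abs_sin_nat_mult_le[of j t] j x unfolding t
          by (smt (verit) atLeastAtMost_iff mult_mono of_nat_0_le_iff of_nat_mono abs_ge_zero)
        then have "\<bar>sin (real j * t)\<bar> \<le> 1 / 2" using m by simp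
        then have "(sin (real j * t))\<^sup>2 \<le> (1 / 2)\<^sup>2"
          by (metis abs_ge_zero power2_abs power_mono)
        moreover have "cos (real (2 * j) * t) = 1 - 2 * (sin (real j * t))\<^sup>2"
          using cos_double_sin[of "real j * t"] by (simp add: mult.assoc)
        ultimately show ?thesis by (simp add: power2_eq_square)
      qed
      then have "(\<Sum>j=1..m. 1 / 2) \<le> (\<Sum>j=1..m. cos (real (2 * j) * t))"
        by (intro sum_mono)
      then show ?thesis unfolding t r by simp
    qed
  qed (rule deg)
qed

lemma integrable_poly_real [simp]:
  fixes p :: "real poly"
  shows "poly p integrable_on {a..b}"
  by (intro integrable_continuous_real continuous_intros)

text \<open>
  The kernel is the fourth power of the Dirichlet polynomial r. Its mass on |x| \<le> 1 / (2 m)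
  alone is at least m^3. For its first absolute moment, |x| \<le> (1 + m^2 x^2) / (2 m) reduces
  everything to the integral of x^2 r^4 \<le> r^2, and r^2 lies below the Lorentz function 2 n^2
  / (1 + n^2 x^2) with n = 2 m + 1, whose integral is O(m). The second power of r would not do:
  its first absolute moment carries a logarithm.
\<close>
lemma jackson_kernel:
  assumes m: "m \<ge> 1"
  obtains k :: "real poly" where "degree k \<le> 8 * m" and "\<And>x. 0 \<le> poly k x"
    and "0 < integral {-1..1} (poly k)"
    and "integral {-1..1} (\<lambda>x. \<bar>x\<bar> * poly k x) \<le> 11 / real m * integral {-1..1} (poly k)"
proof -
  obtain r :: "real poly" where deg: "degree r \<le> 2 * m"
    and r1: "\<And>x. x \<in> {-1..1} \<Longrightarrow> \<bar>poly r x\<bar> \<le> real (2 * m + 1)"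
    and r2: "\<And>x. x \<in> {-1..1} \<Longrightarrow> \<bar>x * poly r x\<bar> \<le> 1"
    and r3: "\<And>x. \<bar>x\<bar> \<le> 1 / (2 * real m) \<Longrightarrow> real m \<le> poly r x"
    using dirichlet_polynomial[OF m] by metis
  define k where "k = r ^ 4"
  define n where "n = real (2 * m + 1)"
  have n: "n > 0" "n \<le> 3 * real m" using m by (auto simp: n_def)
  have k: "poly k x = poly r x ^ 4" for x by (simp add: k_def poly_power)
  have kpos: "0 \<le> poly k x" for x by (simp add: k)
  have "degree k \<le> degree r * 4" unfolding k_def by (rule degree_power_le)
  then have degk: "degree k \<le> 8 * m" using deg by simp
  let ?\<kappa> = "integral {-1..1} (poly k)"
  have \<kappa>: "real m ^ 3 \<le> ?\<kappa>"
  proof -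
    let ?d = "1 / (2 * real m)"
    have d: "0 < ?d" "?d \<le> 1" using m by auto
    have "real m ^ 3 = integral {-?d..?d} (\<lambda>x. real m ^ 4)"
      using m d by (simp add: power3_eq_cube power4_eq_xxxx field_simps)
    also have "\<dots> \<le> integral {-?d..?d} (poly k)"
      by (rule integral_le) (auto simp: k intro!: power_mono r3)
    also have "\<dots> \<le> ?\<kappa>"
      using d kpos by (intro integral_subset_le) auto
    finally show ?thesis .
  qed
  then have \<kappa>pos: "0 < ?\<kappa>" using m by (smt (verit) of_nat_1 of_nat_mono zero_less_power)
  have sq: "integral {-1..1} (\<lambda>x. (poly r x)\<^sup>2) \<le> 2 * pi * n"
  proof -
    have D: "((\<lambda>x. 2 * n * arctan (n * x)) has_vector_derivative 2 * n\<^sup>2 / (1 + n\<^sup>2 * x\<^sup>2))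
          (at x within {-1..1})" for x
    proof -
      have "1 + (n * x)\<^sup>2 > 0" by (intro add_pos_nonneg) auto
      then show ?thesis
        unfolding has_real_derivative_iff_has_vector_derivative[symmetric]
        by (auto intro!: derivative_eq_intros simp: field_simps power2_eq_square)
    qed
    have I: "((\<lambda>x. 2 * n\<^sup>2 / (1 + n\<^sup>2 * x\<^sup>2)) has_integral 2 * n * arctan (n * 1) - 2 * n * arctan (n * (-1))) {-1..1}"
      by (rule fundamental_theorem_of_calculus) (auto intro: D)
    have "integral {-1..1} (\<lambda>x. (poly r x)\<^sup>2) \<le> 2 * n * arctan (n * 1) - 2 * n * arctan (n * (-1))"
    proof (rule has_integral_le[OF integrable_integral I])
      show "(\<lambda>x. (poly r x)\<^sup>2) integrable_on {-1..1}"
        by (intro integrable_continuous_real continuous_intros)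
      fix x :: real assume x: "x \<in> {-1..1}"
      have "\<bar>poly r x\<bar>\<^sup>2 \<le> n\<^sup>2" using r1[OF x] by (intro power_mono) (auto simp: n_def)
      moreover have "\<bar>x * poly r x\<bar>\<^sup>2 \<le> 1" using power_le_one[OF abs_ge_zero r2[OF x]] by blast
      then have "n\<^sup>2 * \<bar>x * poly r x\<bar>\<^sup>2 \<le> n\<^sup>2" by (simp add: mult_left_le)
      ultimately have "(poly r x)\<^sup>2 * (1 + n\<^sup>2 * x\<^sup>2) \<le> 2 * n\<^sup>2"
        by (simp add: algebra_simps power_mult_distrib)
      moreover have "1 + n\<^sup>2 * x\<^sup>2 > 0" by (intro add_pos_nonneg) auto
      ultimately show "(poly r x)\<^sup>2 \<le> 2 * n\<^sup>2 / (1 + n\<^sup>2 * x\<^sup>2)" by (simp add: pos_le_divide_eq)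
    qed
    also have "\<dots> = 4 * n * arctan n" by (simp add: arctan_minus)
    also have "\<dots> \<le> 4 * n * (pi / 2)"
      using n arctan_ubound[of n] by (intro mult_left_mono) auto
    finally show ?thesis by simp
  qed
  have "integral {-1..1} (\<lambda>x. \<bar>x\<bar> * poly k x)
     \<le> integral {-1..1} (\<lambda>x. 1 / (2 * real m) * poly k x + real m / 2 * (poly r x)\<^sup>2)"
  proof (rule integral_le)
    show "(\<lambda>x. \<bar>x\<bar> * poly k x) integrable_on {-1..1}"
      "(\<lambda>x. 1 / (2 * real m) * poly k x + real m / 2 * (poly r x)\<^sup>2) integrable_on {-1..1}"
      by (intro integrable_continuous_real continuous_intros)+
    fix x :: real assume x: "x \<in> {-1..1}"
    have xr: "(x * poly r x)\<^sup>2 \<le> 1" using power_le_one[OF abs_ge_zero r2[OF x], of 2] by simp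
    \<comment> \<open>The arithmetic-geometric mean inequality, balanced at the kernel width 1 / m.\<close>
    have "2 * (real m * \<bar>x\<bar>) \<le> 1 + (real m * \<bar>x\<bar>)\<^sup>2"
      using sum_squares_bound[of 1 "real m * \<bar>x\<bar>"] by simp
    then have "\<bar>x\<bar> \<le> 1 / (2 * real m) + real m / 2 * x\<^sup>2"
      using m by (simp add: field_simps power2_eq_square)
    then have "\<bar>x\<bar> * poly k x \<le> (1 / (2 * real m) + real m / 2 * x\<^sup>2) * poly k x"
      by (intro mult_right_mono kpos)
    also have "\<dots> = 1 / (2 * real m) * poly k x + real m / 2 * ((x * poly r x)\<^sup>2 * (poly r x)\<^sup>2)"
      by (simp add: k algebra_simps power2_eq_square power4_eq_xxxx)
    finally have "\<bar>x\<bar> * poly k x \<le> 1 / (2 * real m) * poly k x + real m / 2 * ((x * poly r x)\<^sup>2 * (poly r x)\<^sup>2)" .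
    also have "\<dots> \<le> 1 / (2 * real m) * poly k x + real m / 2 * (1 * (poly r x)\<^sup>2)"
      using xr by (intro add_left_mono mult_left_mono mult_right_mono) auto
    finally show "\<bar>x\<bar> * poly k x \<le> 1 / (2 * real m) * poly k x + real m / 2 * (poly r x)\<^sup>2" by simp
  qed
  also have "\<dots> = 1 / (2 * real m) * ?\<kappa> + real m / 2 * integral {-1..1} (\<lambda>x. (poly r x)\<^sup>2)"
    using m by (subst integral_add) (auto intro!: integrable_continuous_real continuous_intros)
  also have "\<dots> \<le> 1 / (2 * real m) * ?\<kappa> + real m / 2 * (2 * pi * n)"
    using sq by (intro add_left_mono mult_left_mono) auto
  also have "\<dots> \<le> 1 / (2 * real m) * ?\<kappa> + real m / 2 * (2 * 3.5 * (3 * real m))"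
  proof -
    have "2 * pi * n \<le> 2 * 3.5 * (3 * real m)"
      using n pi_approx by (intro mult_mono) auto
    then show ?thesis by (intro add_left_mono mult_left_mono) auto
  qed
  also have "real m / 2 * (2 * 3.5 * (3 * real m)) = 10.5 / real m * real m ^ 3"
    using m by (simp add: field_simps power3_eq_cube)
  also have "1 / (2 * real m) * ?\<kappa> + 10.5 / real m * real m ^ 3 \<le> 1 / (2 * real m) * ?\<kappa> + 10.5 / real m * ?\<kappa>"
    using \<kappa> by (intro add_left_mono mult_left_mono) auto
  also have "\<dots> = 11 / real m * ?\<kappa>" using m by (simp add: field_simps)
  finally show ?thesis using that degk kpos \<kappa>pos by blast
qed

text \<open>
  Convolution with a polynomial kernel yields a polynomial, whatever the other factor is. The
  induction has to vary f, since splitting off one factor x - y replaces f by y f.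
\<close>
lemma polynomial_convolution:
  fixes P :: "real poly" and f :: "real \<Rightarrow> complex"
  assumes "continuous_on {c..d} f"
  shows "\<exists>R::complex poly. degree R \<le> degree P \<and>
    (\<forall>x::real. poly R (of_real x) = integral {c..d} (\<lambda>y. f y * of_real (poly P (x - y))))"
  using assms
proof (induction P arbitrary: f)
  case 0
  then show ?case by (intro exI[of _ 0]) simp
next
  case (pCons a P)
  have cf: "continuous_on {c..d} (\<lambda>y. of_real y * f y)" by (intro continuous_intros pCons.prems)
  obtain R1 R2 :: "complex poly" where R1: "degree R1 \<le> degree P"
      "\<And>x::real. poly R1 (of_real x) = integral {c..d} (\<lambda>y. f y * of_real (poly P (x - y)))"
    and R2: "degree R2 \<le> degree P"
      "\<And>x::real. poly R2 (of_real x) = integral {c..d} (\<lambda>y. of_real y * f y * of_real (poly P (x - y)))"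
    using pCons.IH[OF pCons.prems] pCons.IH[OF cf] by blast
  let ?R = "[:of_real a * integral {c..d} f:] + [:0, 1:] * R1 - R2"
  have eq: "poly ?R (of_real x) = integral {c..d} (\<lambda>y. f y * of_real (poly (pCons a P) (x - y)))" for x :: real
  proof -
    have "integral {c..d} (\<lambda>y. f y * of_real (poly (pCons a P) (x - y)))
        = integral {c..d} (\<lambda>y. of_real a * f y + of_real x * (f y * of_real (poly P (x - y)))
                        - of_real y * f y * of_real (poly P (x - y)))"
      by (intro integral_cong) (simp add: algebra_simps)
    also have "\<dots> = of_real a * integral {c..d} f
         + of_real x * integral {c..d} (\<lambda>y. f y * of_real (poly P (x - y)))
         - integral {c..d} (\<lambda>y. of_real y * f y * of_real (poly P (x - y)))"
      by (subst integral_diff integral_add integral_mult_right;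
          (intro integrable_continuous_real continuous_intros pCons.prems)?)+ simp
    finally show ?thesis by (simp add: R1 R2)
  qed
  show ?case
  proof (cases "P = 0")
    case True
    then have "R1 = [:coeff R1 0:]" "R2 = [:coeff R2 0:]"
      using R1(1) R2(1) by (auto simp: degree_eq_zeroE elim!: degree_eq_zeroE)
    have z: "poly R1 (of_real x) = 0" "poly R2 (of_real x) = 0" for x :: real by (simp_all add: R1 R2 True)
    have "poly ?R (of_real x) = poly [:of_real a * integral {c..d} f:] (of_real x)" for x :: real
      by (simp add: z)
    then show ?thesis using eq True
      by (intro exI[of _ "[:of_real a * integral {c..d} f:]"]) (simp del: poly_pCons)
  next
    case False
    have "degree ([:0, 1:] * R1) \<le> degree (pCons a P)"
      using degree_mult_le[of "[:0, 1:]" R1] R1(1) False by simp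
    then have "degree ?R \<le> degree (pCons a P)"
      using R2(1) False by (intro degree_diff_le degree_add_le) auto
    then show ?thesis using eq by blast
  qed
qed

text \<open>
  Since g vanishes outside [-1/2, 1/2], its convolution with the kernel over that fixed interval
  (a polynomial in x) is also the integral over [x - 1, x + 1], which contains the full mass of
  the kernel around x. Hence it is a weighted mean of values of g near x, and the first moment
  of the kernel controls the error.
\<close>
lemma jackson_zero_extended:
  fixes g :: "real \<Rightarrow> complex"
  assumes m: "m \<ge> 1" and L: "L \<ge> 0"
    and lip: "\<And>x y. x \<in> {-1/2..1/2} \<Longrightarrow> norm (g x - g y) \<le> L * \<bar>x - y\<bar>"
    and zero: "\<And>y. y \<notin> {-1/2..1/2} \<Longrightarrow> g y = 0"
  shows "\<exists>P::complex poly. degree P \<le> 8 * m \<and>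
    (\<forall>x\<in>{-1/2..1/2}. norm (g x - poly P (of_real x)) \<le> 11 * L / real m)"
proof -
  obtain k :: "real poly" where degk: "degree k \<le> 8 * m" and kpos: "\<And>x. 0 \<le> poly k x"
    and \<kappa>pos: "0 < integral {-1..1} (poly k)"
    and mom: "integral {-1..1} (\<lambda>x. \<bar>x\<bar> * poly k x) \<le> 11 / real m * integral {-1..1} (poly k)"
    using jackson_kernel[OF m] by metis
  let ?\<kappa> = "integral {-1..1} (poly k)"
  have contg: "continuous_on {-1/2..1/2} g"
    by (rule lipschitz_on_continuous_on[of L]) (auto intro!: lipschitz_onI L simp: dist_norm lip)
  obtain R :: "complex poly" where degR: "degree R \<le> degree k"
    and R: "\<And>x::real. poly R (of_real x) = integral {-1/2..1/2} (\<lambda>y. g y * of_real (poly k (x - y)))"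
    using polynomial_convolution[OF contg, of k] by blast
  have reflect: "((\<lambda>y. h (x - y)) has_integral i) {x-1..x+1}"
    if "(h has_integral i) {-1..1}" for h :: "real \<Rightarrow> real" and i x
  proof -
    have "((\<lambda>y. h (- y)) has_integral i) {-1..1}"
      using that has_integral_reflect_real[of h i 1 "-1"] by simp
    then have "((\<lambda>y. h (- y)) has_integral i) (cbox (-1) 1)" by simp
    from has_integral_affinity'[OF this, of 1 "-x"] show ?thesis
      by (simp add: add.commute)
  qed
  show ?thesis
  proof (intro exI conjI ballI)
    show "degree (smult (of_real (1 / ?\<kappa>)) R) \<le> 8 * m" using degR degk by simp
    fix x :: real assume x: "x \<in> {-1/2..1/2}"
    have I1: "((\<lambda>y. poly k (x - y)) has_integral ?\<kappa>) {x-1..x+1}"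
      by (intro reflect integrable_integral) simp
    have I2: "((\<lambda>y. \<bar>x - y\<bar> * poly k (x - y)) has_integral integral {-1..1} (\<lambda>x. \<bar>x\<bar> * poly k x)) {x-1..x+1}"
      by (rule reflect[where h = "\<lambda>s. \<bar>s\<bar> * poly k s"])
        (intro integrable_integral integrable_continuous_real continuous_intros)
    have "((\<lambda>y. g y * of_real (poly k (x - y))) has_integral poly R (of_real x)) {-1/2..1/2}"
      unfolding R by (intro integrable_integral integrable_continuous_real continuous_intros contg)
    then have I3: "((\<lambda>y. g y * of_real (poly k (x - y))) has_integral poly R (of_real x)) {x-1..x+1}"
      by (rule has_integral_on_superset) (use zero x in auto)
    have "((\<lambda>y. g x * of_real (poly k (x - y))) has_integral g x * of_real ?\<kappa>) {x-1..x+1}"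
      by (intro has_integral_mult_right has_integral_of_real I1)
    from has_integral_diff[OF this I3]
    have I4: "((\<lambda>y. (g x - g y) * of_real (poly k (x - y))) has_integral (g x * of_real ?\<kappa> - poly R (of_real x))) {x-1..x+1}"
      by (simp add: algebra_simps)
    have I5: "((\<lambda>y. L * (\<bar>x - y\<bar> * poly k (x - y))) has_integral L * integral {-1..1} (\<lambda>x. \<bar>x\<bar> * poly k x)) {x-1..x+1}"
      by (intro has_integral_mult_right I2)
    have "norm (integral {x-1..x+1} (\<lambda>y. (g x - g y) * of_real (poly k (x - y))))
          \<le> integral {x-1..x+1} (\<lambda>y. L * (\<bar>x - y\<bar> * poly k (x - y)))"
    proof (rule integral_norm_bound_integral)
      show "(\<lambda>y. (g x - g y) * of_real (poly k (x - y))) integrable_on {x-1..x+1}" using I4 by blast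
      show "(\<lambda>y. L * (\<bar>x - y\<bar> * poly k (x - y))) integrable_on {x-1..x+1}" using I5 by blast
      fix y
      show "norm ((g x - g y) * of_real (poly k (x - y))) \<le> L * (\<bar>x - y\<bar> * poly k (x - y))"
        using mult_right_mono[OF lip[OF x, of y] kpos[of "x - y"]] kpos[of "x - y"]
        by (simp add: norm_mult mult.assoc)
    qed
    then have "norm (g x * of_real ?\<kappa> - poly R (of_real x)) \<le> L * integral {-1..1} (\<lambda>x. \<bar>x\<bar> * poly k x)"
      unfolding integral_unique[OF I4] integral_unique[OF I5] .
    also have "\<dots> \<le> L * (11 / real m * ?\<kappa>)" by (intro mult_left_mono mom L)
    finally have *: "norm (g x * of_real ?\<kappa> - poly R (of_real x)) \<le> 11 * L / real m * ?\<kappa>" by (simp add: ac_simps)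
    have "g x - poly (smult (of_real (1 / ?\<kappa>)) R) (of_real x) = (g x * of_real ?\<kappa> - poly R (of_real x)) / of_real ?\<kappa>"
      using \<kappa>pos by (simp add: field_simps)
    then have "norm (g x - poly (smult (of_real (1 / ?\<kappa>)) R) (of_real x)) = norm (g x * of_real ?\<kappa> - poly R (of_real x)) / ?\<kappa>"
      using \<kappa>pos by (simp only: norm_divide) simp
    also have "\<dots> \<le> 11 * L / real m"
      using * \<kappa>pos by (simp add: pos_divide_le_eq)
    finally show "norm (g x - poly (smult (of_real (1 / ?\<kappa>)) R) (of_real x)) \<le> 11 * L / real m" .
  qed
qed

text \<open>
  Subtracting the linear interpolant at the two endpoints makes the extension by zero Lipschitz;
  this at most doubles the Lipschitz constant, and an affine change of variable does the rest.
  The kernel has degree 8 m with m = N div 8, hence the separate trivial case N < 8. The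
  constant is 704 = 11 * 4 * 16: the constant of the kernel, the Lipschitz constant 4 b L of the
  rescaled difference, and N \<le> 16 m.
\<close>
lemma jackson_lipschitz:
  fixes g :: "real \<Rightarrow> complex"
  assumes b: "b > 0" and N: "N \<ge> 1"
    and lip: "\<And>x y. x \<in> {-b..b} \<Longrightarrow> y \<in> {-b..b} \<Longrightarrow> norm (g x - g y) \<le> L * \<bar>x - y\<bar>"
  shows "\<exists>P::complex poly. degree P \<le> N \<and>
    (\<forall>x\<in>{-b..b}. norm (g x - poly P (of_real x)) \<le> 704 * b * L / real N)"
proof -
  have "norm (g b - g (-b)) \<le> L * (2 * b)" using lip[of b "-b"] b by simp
  then have L: "L \<ge> 0" using b norm_ge_zero[of "g b - g (-b)"]
    by (smt (verit) zero_le_mult_iff)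
  show ?thesis
  proof (cases "N < 8")
    case True
    have "norm (g x - poly [:g 0:] (of_real x)) \<le> 704 * b * L / real N" if x: "x \<in> {-b..b}" for x
    proof -
      have "norm (g x - g 0) \<le> L * \<bar>x - 0\<bar>" using x b by (intro lip) auto
      also have "\<dots> \<le> L * b" using x L by (intro mult_left_mono) auto
      also have "\<dots> \<le> 704 * b * L / real N"
        using N True b L mult_right_mono[of "real N" 704 "b * L"] by (simp add: field_simps)
      finally show ?thesis by simp
    qed
    then show ?thesis by (intro exI[of _ "[:g 0:]"]) simp
  next
    case False
    define m where "m = N div 8"
    have m: "m \<ge> 1" "8 * m \<le> N" "N \<le> 16 * m" using False unfolding m_def by presburger+
    define s where "s = (g b - g (-b)) / of_real (2 * b)"
    have s: "norm s \<le> L"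
      using \<open>norm (g b - g (-b)) \<le> L * (2 * b)\<close> b by (simp add: s_def norm_divide pos_divide_le_eq)
    define l where "l x = g (-b) + s * of_real (x + b)" for x :: real
    have l: "l b = g b" "l (-b) = g (-b)"
      using b by (simp_all add: l_def s_def field_simps)
    define G where "G y = (if y \<in> {-1/2..1/2} then g (2 * b * y) - l (2 * b * y) else 0)" for y :: real
    have arg: "2 * b * x \<in> {-b..b}" if "x \<in> {-1/2..1/2}" for x
    proof -
      have "b * (2 * x) \<le> b * 1" "b * (-1) \<le> b * (2 * x)"
        using that b by (intro mult_left_mono; simp)+
      then show ?thesis by (simp add: ac_simps)
    qed
    have lipG: "norm (G x - G y) \<le> 4 * b * L * \<bar>x - y\<bar>"
      if x: "x \<in> {-1/2..1/2}" and y: "y \<in> {-1/2..1/2}" for x y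
    proof -
      have "G x - G y = (g (2 * b * x) - g (2 * b * y)) - s * of_real (2 * b * (x - y))"
        using x y by (simp add: G_def l_def algebra_simps)
      also have "norm \<dots> \<le> norm (g (2 * b * x) - g (2 * b * y)) + norm (s * of_real (2 * b * (x - y)))"
        by (rule norm_triangle_ineq4)
      also have "\<dots> \<le> L * \<bar>2 * b * x - 2 * b * y\<bar> + L * \<bar>2 * b * (x - y)\<bar>"
        unfolding norm_mult norm_of_real by (intro add_mono mult_right_mono lip arg x y s) auto
      also have "\<bar>2 * b * x - 2 * b * y\<bar> = 2 * b * \<bar>x - y\<bar>"
        using b by (simp add: abs_mult flip: right_diff_distrib)
      also have "\<bar>2 * b * (x - y)\<bar> = 2 * b * \<bar>x - y\<bar>" using b by (simp add: abs_mult)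
      finally show ?thesis by (simp add: algebra_simps)
    qed
    have G0: "G (1/2) = 0" "G (-1/2) = 0" using l by (simp_all add: G_def)
    have lipG': "norm (G x - G y) \<le> 4 * b * L * \<bar>x - y\<bar>" if x: "x \<in> {-1/2..1/2}" for x y
    proof -
      define e :: real where "e = max (-1/2) (min (1/2) y)"
      have e: "e \<in> {-1/2..1/2}" "\<bar>x - e\<bar> \<le> \<bar>x - y\<bar>" using x by (auto simp: e_def max_def min_def)
      have "G y = G e"
      proof (cases "y \<in> {-1/2..1/2}")
        case True
        then have "e = y" by (simp add: e_def)
        then show ?thesis by simp
      next
        case False
        then have "e = 1/2 \<or> e = -1/2" "G y = 0" by (auto simp: e_def G_def max_def min_def)
        then show ?thesis using G0 by metis
      qed
      then have "norm (G x - G y) \<le> 4 * b * L * \<bar>x - e\<bar>" using lipG[OF x e(1)] by simp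
      also have "\<dots> \<le> 4 * b * L * \<bar>x - y\<bar>" using b L by (intro mult_left_mono e) auto
      finally show ?thesis .
    qed
    obtain P :: "complex poly" where degP: "degree P \<le> 8 * m"
      and P: "\<And>x. x \<in> {-1/2..1/2} \<Longrightarrow> norm (G x - poly P (of_real x)) \<le> 11 * (4 * b * L) / real m"
    proof -
      have "0 \<le> 4 * b * L" using b L by simp
      moreover have "G y = 0" if "y \<notin> {-1/2..1/2}" for y using that unfolding G_def by (rule if_not_P)
      ultimately show ?thesis using jackson_zero_extended[OF m(1) _ lipG'] that by blast
    qed
    define Q where "Q = pcompose P [:0, of_real (1 / (2 * b)):] + [:g (-b) + s * of_real b, s:]"
    have "degree (pcompose P [:0, of_real (1 / (2 * b)):]) \<le> N"
      using degP m by (intro order_trans[OF degree_pcompose_le]) auto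
    then have "degree Q \<le> N" unfolding Q_def using N by (intro degree_add_le) auto
    moreover have "norm (g x - poly Q (of_real x)) \<le> 704 * b * L / real N" if x: "x \<in> {-b..b}" for x
    proof -
      define y where "y = x / (2 * b)"
      have y: "y \<in> {-1/2..1/2}" "x = 2 * b * y" using x b by (auto simp: y_def field_simps)
      have "g x - poly Q (of_real x) = G y - poly P (of_real y)"
        using y b by (simp add: Q_def poly_pcompose G_def l_def algebra_simps)
      also have "norm \<dots> \<le> 11 * (4 * b * L) / real m" by (rule P[OF y(1)])
      also have "\<dots> = 704 * b * L / (16 * real m)" by (simp add: field_simps)
      also have "\<dots> \<le> 704 * b * L / real N"
        using b L m N by (intro divide_left_mono) auto
      finally show ?thesis .
    qed
    ultimately show ?thesis by blast
  qed
qed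

lemma pderiv_surj:
  fixes Q :: "complex poly"
  obtains R where "pderiv R = Q" "degree R \<le> Suc (degree Q)"
proof
  let ?R = "\<Sum>i\<le>degree Q. monom (coeff Q i / of_nat (Suc i)) (Suc i)"
  have "pderiv ?R = (\<Sum>i\<le>degree Q. monom (coeff Q i) i)"
    using higher_pderiv_sum[of 1 "\<lambda>i. monom (coeff Q i / of_nat (Suc i)) (Suc i)"]
    by (simp add: pderiv_monom del: of_nat_Suc)
  then show "pderiv ?R = Q" by (simp add: poly_as_sum_of_monoms)
  show "degree ?R \<le> Suc (degree Q)"
    by (intro degree_sum_le) (auto intro!: order_trans[OF degree_monom_le])
qed

lemma Ck_on_continuous_on: "Ck_on m g S \<Longrightarrow> continuous_on S g"
  by (cases m) (auto simp: continuous_on_eq_continuous_within intro: has_vector_derivative_continuous)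

text \<open>
  One derivative is worth one factor 1 / N: if Q approximates g' within e and R is an
  antiderivative of Q, then g - R is e-Lipschitz.
\<close>
lemma jackson_step:
  fixes g g' :: "real \<Rightarrow> complex"
  assumes b: "b > 0" and N: "N \<ge> 1"
    and der: "\<And>x. x \<in> {-b..b} \<Longrightarrow> (g has_vector_derivative g' x) (at x within {-b..b})"
    and Q: "Suc (degree Q) \<le> N"
    and err: "\<And>x. x \<in> {-b..b} \<Longrightarrow> norm (g' x - poly Q (of_real x)) \<le> e"
  shows "\<exists>P::complex poly. degree P \<le> N \<and>
    (\<forall>x\<in>{-b..b}. norm (g x - poly P (of_real x)) \<le> 704 * b * e / real N)"
proof -
  obtain R where R: "pderiv R = Q" "degree R \<le> Suc (degree Q)" by (rule pderiv_surj)
  have lip: "norm ((g x - poly R (of_real x)) - (g y - poly R (of_real y))) \<le> e * \<bar>x - y\<bar>"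
    if "x \<in> {-b..b}" "y \<in> {-b..b}" for x y
  proof -
    have dR: "((\<lambda>x. poly R (of_real x)) has_vector_derivative poly Q (of_real x)) (at x within {-b..b})" for x
      using has_vector_derivative_real_field[OF poly_DERIV[of R "of_real x"]] R(1)
      by (simp add: has_vector_derivative_at_within)
    have "((\<lambda>x. g x - poly R (of_real x)) has_derivative (\<lambda>h. h *\<^sub>R (g' x - poly Q (of_real x)))) (at x within {-b..b})"
      if "x \<in> {-b..b}" for x
      using has_vector_derivative_diff[OF der[OF that] dR[of x]] by (simp add: has_vector_derivative_def)
    moreover have "onorm (\<lambda>h::real. h *\<^sub>R (g' x - poly Q (of_real x))) \<le> e" if "x \<in> {-b..b}" for x
      by (rule onorm_le) (use mult_left_mono[OF err[OF that] abs_ge_zero] in \<open>simp add: mult.commute\<close>)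
    ultimately show ?thesis
      using differentiable_bound[of "{-b..b}" "\<lambda>x. g x - poly R (of_real x)"
          "\<lambda>x h. h *\<^sub>R (g' x - poly Q (of_real x))" e x y] that
      by simp
  qed
  obtain P :: "complex poly" where P: "degree P \<le> N"
    "\<And>x. x \<in> {-b..b} \<Longrightarrow> norm ((g x - poly R (of_real x)) - poly P (of_real x)) \<le> 704 * b * e / real N"
    using jackson_lipschitz[OF b N lip] by blast
  have "degree (R + P) \<le> N" using R P Q by (intro degree_add_le) auto
  then show ?thesis using P(2) by (intro exI[of _ "R + P"]) (simp add: algebra_simps)
qed

text \<open>
  Iterating the previous step on the derivatives of g. The polynomial for g' may only have
  degree N - 1, which changes N^m by at most the factor 2^m.
\<close>
lemma Ck_on_polynomial_rate:
  assumes b: "b > 0" and "Ck_on m g {-b..b}"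
  shows "\<exists>c\<ge>0. \<forall>N\<ge>1. \<exists>P::complex poly. degree P \<le> N \<and>
    (\<forall>x\<in>{-b..b}. norm (g x - poly P (of_real x)) \<le> c / real N ^ m)"
  using assms(2)
proof (induction m arbitrary: g)
  case 0
  then have "bounded (g ` {-b..b})"
    by (intro compact_imp_bounded compact_continuous_image) auto
  then obtain c where "\<forall>x\<in>{-b..b}. norm (g x) \<le> c" by (auto simp: bounded_iff)
  moreover have "0 \<le> c" using calculation b order_trans[OF norm_ge_zero] by force
  ultimately show ?case by (intro exI[of _ c] conjI allI impI exI[of _ 0]) auto
next
  case (Suc m)
  then obtain g' where der: "\<And>x. x \<in> {-b..b} \<Longrightarrow> (g has_vector_derivative g' x) (at x within {-b..b})"
    and g': "Ck_on m g' {-b..b}" unfolding Ck_on.simps by blast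
  obtain c where c0: "c \<ge> 0" and c: "\<And>N. N \<ge> 1 \<Longrightarrow> \<exists>P::complex poly. degree P \<le> N \<and>
    (\<forall>x\<in>{-b..b}. norm (g' x - poly P (of_real x)) \<le> c / real N ^ m)" using Suc.IH[OF g'] by blast
  have "bounded (g' ` {-b..b})"
    using Ck_on_continuous_on[OF g'] by (intro compact_imp_bounded compact_continuous_image) auto
  then obtain B where B: "\<And>x. x \<in> {-b..b} \<Longrightarrow> norm (g' x) \<le> B" unfolding bounded_iff by blast
  have B0: "0 \<le> B" using B[of 0] b order_trans[OF norm_ge_zero] by force
  have "\<exists>Q::complex poly. Suc (degree Q) \<le> N \<and>
      (\<forall>x\<in>{-b..b}. norm (g' x - poly Q (of_real x)) \<le> (c * 2 ^ m + B) / real N ^ m)" if N: "N \<ge> 1" for N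
  proof (cases "N = 1")
    case True
    have "0 \<le> c * 2 ^ m" using c0 by simp
    then have "norm (g' x) \<le> c * 2 ^ m + B" if "x \<in> {-b..b}" for x using B[OF that] by linarith
    then show ?thesis using True by (intro exI[of _ 0]) auto
  next
    case False
    then have "N - 1 \<ge> 1" using N by simp
    from c[OF this] obtain Q :: "complex poly" where Q: "degree Q \<le> N - 1"
      "\<And>x. x \<in> {-b..b} \<Longrightarrow> norm (g' x - poly Q (of_real x)) \<le> c / real (N - 1) ^ m" by blast
    have "real N / 2 \<le> real (N - 1)" using False N by simp
    then have "(real N / 2) ^ m \<le> real (N - 1) ^ m" using N by (intro power_mono) auto
    then have "c / real (N - 1) ^ m \<le> c / (real N / 2) ^ m"
      using c0 N False by (intro divide_left_mono mult_pos_pos zero_less_power) auto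
    also have "\<dots> = c * 2 ^ m / real N ^ m" by (simp add: power_divide)
    also have "\<dots> \<le> (c * 2 ^ m + B) / real N ^ m" using B0 by (intro divide_right_mono) auto
    finally have "c / real (N - 1) ^ m \<le> (c * 2 ^ m + B) / real N ^ m" .
    then have "norm (g' x - poly Q (of_real x)) \<le> (c * 2 ^ m + B) / real N ^ m" if "x \<in> {-b..b}" for x
      using Q(2)[OF that] by linarith
    then show ?thesis using Q(1) N False by (intro exI[of _ Q]) auto
  qed
  then have "\<exists>P::complex poly. degree P \<le> N \<and>
      (\<forall>x\<in>{-b..b}. norm (g x - poly P (of_real x)) \<le> 704 * b * ((c * 2 ^ m + B) / real N ^ m) / real N)"
    if "N \<ge> 1" for N
    using jackson_step[OF b that der] that by blast
  then show ?case using b c0 B0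
    by (intro exI[of _ "704 * b * (c * 2 ^ m + B)"]) (auto simp: mult_ac)
qed

section \<open>Functions of class C^k on a square\<close>

text \<open>
  The form in which Gronwall's argument is used throughout: one integration from c gains the
  factor 1 / lam against the weight exp (lam * |s - c|), in both directions, so that for large
  lam every Volterra operator becomes a contraction.
\<close>
lemma weighted_increment_bound:
  fixes y y' :: "real \<Rightarrow> 'a::real_normed_vector"
  assumes lam: "lam > 0" and B: "B \<ge> 0"
    and der: "\<And>s. s \<in> closed_segment c d \<Longrightarrow> (y has_vector_derivative y' s) (at s within closed_segment c d)"
    and bnd: "\<And>s. s \<in> closed_segment c d \<Longrightarrow> norm (y' s) \<le> B * exp (lam * \<bar>s - c\<bar>)"
  shows "norm (y d - y c) \<le> B / lam * exp (lam * \<bar>d - c\<bar>)"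
proof -
  have cont: "continuous_on (closed_segment c d) y"
    by (auto simp: continuous_on_eq_continuous_within intro: has_vector_derivative_continuous der)
  consider "c = d" | "c < d" | "d < c" by linarith
  then show ?thesis
  proof cases
    case 1 then show ?thesis using lam B by simp
  next
    case 2
    then have seg: "closed_segment c d = {c..d}" by (simp add: closed_segment_eq_real_ivl)
    have "norm (y d - y c) \<le> B / lam * exp (lam * (d - c)) - B / lam * exp (lam * (c - c))"
    proof (rule differentiable_bound_general[OF 2])
      show "continuous_on {c..d} y" using cont seg by simp
      show "continuous_on {c..d} (\<lambda>s. B / lam * exp (lam * (s - c)))" by (intro continuous_intros)
      fix x assume x: "c < x" "x < d"
      show "(y has_vector_derivative y' x) (at x)"
        using der[of x] x unfolding seg by (simp add: at_within_Icc_at)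
      show "((\<lambda>s. B / lam * exp (lam * (s - c))) has_vector_derivative B * exp (lam * (x - c))) (at x)"
        unfolding has_real_derivative_iff_has_vector_derivative[symmetric]
        using lam by (auto intro!: derivative_eq_intros)
      show "norm (y' x) \<le> B * exp (lam * (x - c))" using bnd[of x] x unfolding seg by simp
    qed
    moreover have "0 \<le> B / lam" using B lam by simp
    ultimately show ?thesis using 2 by simp
  next
    case 3
    then have seg: "closed_segment c d = {d..c}" by (simp add: closed_segment_eq_real_ivl)
    have "norm (y c - y d) \<le> - B / lam * exp (lam * (c - c)) - (- B / lam * exp (lam * (c - d)))"
    proof (rule differentiable_bound_general[OF 3])
      show "continuous_on {d..c} y" using cont seg by simp
      show "continuous_on {d..c} (\<lambda>s. - B / lam * exp (lam * (c - s)))" by (intro continuous_intros)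
      fix x assume x: "d < x" "x < c"
      show "(y has_vector_derivative y' x) (at x)"
        using der[of x] x unfolding seg by (simp add: at_within_Icc_at)
      show "((\<lambda>s. - B / lam * exp (lam * (c - s))) has_vector_derivative B * exp (lam * (c - x))) (at x)"
        unfolding has_real_derivative_iff_has_vector_derivative[symmetric]
        using lam by (auto intro!: derivative_eq_intros)
      show "norm (y' x) \<le> B * exp (lam * (c - x))" using bnd[of x] x unfolding seg by simp
    qed
    moreover have "0 \<le> B / lam" using B lam by simp
    ultimately show ?thesis using 3 by (simp add: norm_minus_commute)
  qed
qed

text \<open>
  The oriented integral of g from 0 to x, rescaled to the fixed interval [0, 1]; in this form
  negative x needs no separate treatment and dependence on parameters can be differentiated
  under the integral.
\<close>
definition primitive :: "(real \<Rightarrow> complex) \<Rightarrow> real \<Rightarrow> complex" where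
  "primitive g x = x *\<^sub>R integral {0..1} (\<lambda>s. g (s * x))"

lemma primitive_0 [simp]: "primitive g 0 = 0" by (simp add: primitive_def)

lemma scaled_arg: "s \<in> {0..1} \<Longrightarrow> x \<in> {-b..b} \<Longrightarrow> s * x \<in> {-b..b::real}"
proof -
  assume s: "s \<in> {0..1}" and x: "x \<in> {-b..b}"
  have "\<bar>s * x\<bar> \<le> 1 * b" unfolding abs_mult using s x by (intro mult_mono) auto
  then show ?thesis by auto
qed

lemma scaled_arg_ge: "0 \<le> s \<Longrightarrow> s \<le> 1 \<Longrightarrow> -b \<le> x \<Longrightarrow> x \<le> b \<Longrightarrow> -b \<le> s * (x::real)"
  and scaled_arg_le: "0 \<le> s \<Longrightarrow> s \<le> 1 \<Longrightarrow> -b \<le> x \<Longrightarrow> x \<le> b \<Longrightarrow> s * (x::real) \<le> b"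
  using scaled_arg[of s x b] by simp_all

lemma primitive_has_vector_derivative:
  assumes g: "continuous_on {-b..b} g" and u: "u \<in> {-b..b}"
  shows "(primitive g has_vector_derivative g u) (at u within {-b..b})"
proof -
  define G where "G x = integral {-b..x} g" for x
  have G: "(G has_vector_derivative g x) (at x within {-b..b})" if "x \<in> {-b..b}" for x
    unfolding G_def by (rule integral_has_vector_derivative[OF g that])
  have "primitive g x = G x - G 0" if x: "x \<in> {-b..b}" for x
  proof -
    have "((\<lambda>s. x *\<^sub>R g (s * x)) has_integral G (1 * x) - G (0 * x)) {0..1}"
    proof (rule fundamental_theorem_of_calculus)
      fix s :: real assume s: "s \<in> {0..1}"
      have "((\<lambda>s. s * x) has_vector_derivative x) (at s within {0..1})"
        by (auto intro!: derivative_eq_intros simp flip: has_real_derivative_iff_has_vector_derivative)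
      moreover have "(G has_vector_derivative g (s * x)) (at (s * x) within (\<lambda>s. s * x) ` {0..1})"
        by (rule has_vector_derivative_within_subset[OF G])
          (use x s in \<open>auto intro!: scaled_arg_ge scaled_arg_le\<close>)
      ultimately have "((G \<circ> (\<lambda>s. s * x)) has_vector_derivative x *\<^sub>R g (s * x)) (at s within {0..1})"
        by (rule vector_diff_chain_within)
      then show "((\<lambda>s. G (s * x)) has_vector_derivative x *\<^sub>R g (s * x)) (at s within {0..1})"
        by (simp add: o_def)
    qed simp
    from integral_unique[OF this] show ?thesis by (simp add: primitive_def)
  qed
  moreover have "((\<lambda>x. G x - G 0) has_vector_derivative g u) (at u within {-b..b})"
    using has_vector_derivative_diff[OF G[OF u] has_vector_derivative_const[of "G 0"]] by simp
  ultimately show ?thesis by (rule has_vector_derivative_transform[OF u])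
qed

lemma primitive_weighted_bound:
  assumes g: "continuous_on {-b..b} g" and x: "x \<in> {-b..b}" and lam: "lam > 0" and M: "M \<ge> 0"
    and bnd: "\<And>y. y \<in> {-b..b} \<Longrightarrow> norm (g y) \<le> M * exp (lam * \<bar>y\<bar>)"
  shows "norm (primitive g x) \<le> M / lam * exp (lam * \<bar>x\<bar>)"
proof -
  have sub: "closed_segment 0 x \<subseteq> {-b..b}" using x by (auto simp: closed_segment_eq_real_ivl)
  have "norm (primitive g x - primitive g 0) \<le> M / lam * exp (lam * \<bar>x - 0\<bar>)"
    by (rule weighted_increment_bound[OF lam M, where y' = g])
      (use sub bnd in \<open>auto intro: has_vector_derivative_within_subset[OF primitive_has_vector_derivative[OF g] sub]\<close>)
  then show ?thesis by simp
qed

lemma primitive_bound: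
  assumes g: "continuous_on {-b..b} g" and x: "x \<in> {-b..b}"
    and bnd: "\<And>y. y \<in> {-b..b} \<Longrightarrow> norm (g y) \<le> M"
  shows "norm (primitive g x) \<le> \<bar>x\<bar> * M"
proof -
  have "norm (integral {0..1} (\<lambda>s. g (s * x))) \<le> M * (1 - 0)"
    by (rule integral_bound)
      (use x in \<open>auto intro!: bnd continuous_on_compose2[OF g] continuous_intros scaled_arg_ge scaled_arg_le\<close>)
  then show ?thesis by (simp add: primitive_def mult_left_mono)
qed

lemma primitive_diff:
  assumes "continuous_on {-b..b} g" "continuous_on {-b..b} k" and x: "x \<in> {-b..b}"
  shows "primitive (\<lambda>s. g s - k s) x = primitive g x - primitive k x"
proof -
  have "(\<lambda>s. h (s * x)) integrable_on {0..1}" if "continuous_on {-b..b} h" for h :: "real \<Rightarrow> complex"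
    by (intro integrable_continuous_real continuous_on_compose2[OF that] continuous_intros)
      (use x in \<open>auto intro!: scaled_arg_ge scaled_arg_le\<close>)
  then show ?thesis using assms by (simp add: primitive_def integral_diff scaleR_diff_right)
qed

lemma continuous_on_primitive_param:
  assumes F: "continuous_on (T \<times> {-b..b}) (\<lambda>(t, x). F t x)"
  shows "continuous_on (T \<times> {-b..b}) (\<lambda>(t, x). primitive (F t) x)"
proof -
  have "continuous_on (T \<times> {-b..b}) (\<lambda>z. integral (cbox 0 1) (\<lambda>s. F (fst z) (s * snd z)))"
  proof (rule integral_continuous_on_param)
    have "continuous_on ((T \<times> {-b..b}) \<times> cbox 0 1) (\<lambda>w. (\<lambda>(t, x). F t x) (fst (fst w), snd w * snd (fst w)))"
      by (rule continuous_on_compose2[OF F]) (auto intro!: continuous_intros scaled_arg_ge scaled_arg_le)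
    then show "continuous_on ((T \<times> {-b..b}) \<times> cbox 0 1) (\<lambda>(z, s). F (fst z) (s * snd z))"
      by (simp add: case_prod_unfold)
  qed
  then have "continuous_on (T \<times> {-b..b}) (\<lambda>z. snd z *\<^sub>R integral (cbox 0 1) (\<lambda>s. F (fst z) (s * snd z)))"
    by (intro continuous_intros)
  then show ?thesis by (simp add: primitive_def case_prod_unfold)
qed

lemma primitive_param_has_vector_derivative:
  assumes T: "convex T" "t \<in> T" and x: "x \<in> {-b..b}"
    and F: "\<And>t. t \<in> T \<Longrightarrow> continuous_on {-b..b} (F t)"
    and der: "\<And>t y. t \<in> T \<Longrightarrow> y \<in> {-b..b} \<Longrightarrow> ((\<lambda>t. F t y) has_vector_derivative F' t y) (at t within T)"
    and F': "continuous_on (T \<times> {-b..b}) (\<lambda>(t, y). F' t y)"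
  shows "((\<lambda>t. primitive (F t) x) has_vector_derivative primitive (F' t) x) (at t within T)"
proof -
  have "((\<lambda>t. integral (cbox 0 1) (\<lambda>s. F t (s * x))) has_vector_derivative
      integral (cbox 0 1) (\<lambda>s. F' t (s * x))) (at t within T)"
  proof (rule leibniz_rule_vector_derivative[OF _ _ _ T(2,1)])
    show "((\<lambda>t. F t (s * x)) has_vector_derivative F' t (s * x)) (at t within T)"
      if "t \<in> T" "s \<in> cbox 0 1" for t s
      using that x by (intro der) (auto intro!: scaled_arg_ge scaled_arg_le)
    show "(\<lambda>s. F t (s * x)) integrable_on cbox 0 1" if "t \<in> T" for t
      unfolding interval_cbox[symmetric]
      by (intro integrable_continuous_real continuous_on_compose2[OF F[OF that]] continuous_intros)
        (use x in \<open>auto intro!: scaled_arg_ge scaled_arg_le\<close>)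
    have "continuous_on (T \<times> cbox 0 1) (\<lambda>w. (\<lambda>(t, y). F' t y) (fst w, snd w * x))"
      by (rule continuous_on_compose2[OF F']) (use x in \<open>auto intro!: continuous_intros scaled_arg_ge scaled_arg_le\<close>)
    then show "continuous_on (T \<times> cbox 0 1) (\<lambda>(t, s). F' t (s * x))" by (simp add: case_prod_unfold)
  qed
  then show ?thesis unfolding primitive_def interval_cbox
    by (auto intro!: derivative_eq_intros)
qed

abbreviation square :: "real \<Rightarrow> (real \<times> real) set" where
  "square b \<equiv> {-b..b} \<times> {-b..b}"

definition has_grad :: "real \<Rightarrow> (real \<times> real \<Rightarrow> complex) \<Rightarrow> (real \<times> real \<Rightarrow> complex) \<Rightarrow> (real \<times> real \<Rightarrow> complex) \<Rightarrow> bool" where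
  "has_grad b F Fu Fv \<longleftrightarrow>
     (\<forall>z\<in>square b. (F has_derivative (\<lambda>(h, l). h *\<^sub>R Fu z + l *\<^sub>R Fv z)) (at z within square b))"

primrec Ck2 :: "nat \<Rightarrow> real \<Rightarrow> (real \<times> real \<Rightarrow> complex) \<Rightarrow> bool" where
  "Ck2 0 b F \<longleftrightarrow> continuous_on (square b) F"
| "Ck2 (Suc k) b F \<longleftrightarrow> (\<exists>Fu Fv. has_grad b F Fu Fv \<and> Ck2 k b Fu \<and> Ck2 k b Fv)"

lemma has_grad_continuous_on: "has_grad b F Fu Fv \<Longrightarrow> continuous_on (square b) F"
  unfolding has_grad_def continuous_on_eq_continuous_within by (blast intro: has_derivative_continuous)

lemma Ck2_continuous_on: "Ck2 k b F \<Longrightarrow> continuous_on (square b) F"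
  by (cases k) (auto intro: has_grad_continuous_on)

lemma has_grad_path:
  assumes F: "has_grad b F Fu Fv"
    and \<gamma>: "(\<gamma> has_vector_derivative (a, c)) (at t within T)"
    and T: "t \<in> T" "\<gamma> ` T \<subseteq> square b"
  shows "((\<lambda>t. F (\<gamma> t)) has_vector_derivative a *\<^sub>R Fu (\<gamma> t) + c *\<^sub>R Fv (\<gamma> t)) (at t within T)"
proof -
  have "(F has_derivative (\<lambda>(h, l). h *\<^sub>R Fu (\<gamma> t) + l *\<^sub>R Fv (\<gamma> t))) (at (\<gamma> t) within \<gamma> ` T)"
    using F T unfolding has_grad_def by (blast intro: has_derivative_subset)
  from diff_chain_within[OF \<gamma>[unfolded has_vector_derivative_def] this]
  show ?thesis by (simp add: has_vector_derivative_def o_def scaleR_right_distrib)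
qed

lemma has_grad_partials:
  assumes F: "has_grad b F Fu Fv" and z: "u \<in> {-b..b}" "v \<in> {-b..b}"
  shows "((\<lambda>u. F (u, v)) has_vector_derivative Fu (u, v)) (at u within {-b..b})"
    and "((\<lambda>v. F (u, v)) has_vector_derivative Fv (u, v)) (at v within {-b..b})"
proof -
  have "((\<lambda>u. (u, v)) has_vector_derivative (1, 0)) (at u within {-b..b})"
    unfolding has_vector_derivative_def by (auto intro!: derivative_eq_intros)
  from has_grad_path[OF F this z(1)] z
  show "((\<lambda>u. F (u, v)) has_vector_derivative Fu (u, v)) (at u within {-b..b})" by (auto simp: image_subset_iff)
  have "((\<lambda>v. (u, v)) has_vector_derivative (0, 1)) (at v within {-b..b})"
    unfolding has_vector_derivative_def by (auto intro!: derivative_eq_intros)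
  from has_grad_path[OF F this z(2)] z
  show "((\<lambda>v. F (u, v)) has_vector_derivative Fv (u, v)) (at v within {-b..b})" by (auto simp: image_subset_iff)
qed

lemma has_grad_partialsI:
  assumes "\<And>u v. u \<in> {-b..b} \<Longrightarrow> v \<in> {-b..b} \<Longrightarrow>
      ((\<lambda>u. F (u, v)) has_vector_derivative Fu (u, v)) (at u within {-b..b})"
    and "\<And>u v. u \<in> {-b..b} \<Longrightarrow> v \<in> {-b..b} \<Longrightarrow>
      ((\<lambda>v. F (u, v)) has_vector_derivative Fv (u, v)) (at v within {-b..b})"
    and cont: "continuous_on (square b) Fv"
  shows "has_grad b F Fu Fv"
  unfolding has_grad_def
proof
  fix z assume "z \<in> square b"
  then obtain u v where z: "z = (u, v)" "u \<in> {-b..b}" "v \<in> {-b..b}" by auto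
  have "((\<lambda>(x, y). F (x, y)) has_derivative (\<lambda>(h, l). h *\<^sub>R Fu (u, v) + blinfun_scaleR_left (Fv (u, v)) l))
      (at (u, v) within {-b..b} \<times> {-b..b})"
  proof (rule has_derivative_partialsI[where fy = "\<lambda>x y. blinfun_scaleR_left (Fv (x, y))"])
    show "((\<lambda>x. F (x, v)) has_derivative (\<lambda>h. h *\<^sub>R Fu (u, v))) (at u within {-b..b})"
      using assms(1)[OF z(2,3)] by (simp add: has_vector_derivative_def)
    show "((\<lambda>y. F (x, y)) has_derivative blinfun_scaleR_left (Fv (x, y))) (at y within {-b..b})"
      if "x \<in> {-b..b}" "y \<in> {-b..b}" for x y
      using assms(2)[OF that] by (simp add: has_vector_derivative_def)
    have "continuous_on (square b) (\<lambda>z. blinfun_scaleR_left (Fv z))"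
      by (intro continuous_intros cont)
    then show "continuous (at (u, v) within {-b..b} \<times> {-b..b}) (\<lambda>(x, y). blinfun_scaleR_left (Fv (x, y)))"
      using z by (auto simp: continuous_on_eq_continuous_within case_prod_unfold)
  qed (use z in auto)
  then show "(F has_derivative (\<lambda>(h, l). h *\<^sub>R Fu z + l *\<^sub>R Fv z)) (at z within square b)"
    using z(1) by simp
qed

lemma has_grad_add:
  "has_grad b F Fu Fv \<Longrightarrow> has_grad b G Gu Gv \<Longrightarrow>
    has_grad b (\<lambda>z. F z + G z) (\<lambda>z. Fu z + Gu z) (\<lambda>z. Fv z + Gv z)"
  unfolding has_grad_def
  by (auto intro!: derivative_eq_intros simp: algebra_simps case_prod_unfold)

lemma has_grad_mult:
  "has_grad b F Fu Fv \<Longrightarrow> has_grad b G Gu Gv \<Longrightarrow>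
    has_grad b (\<lambda>z. F z * G z) (\<lambda>z. F z * Gu z + Fu z * G z) (\<lambda>z. F z * Gv z + Fv z * G z)"
  unfolding has_grad_def
  by (auto intro!: derivative_eq_intros simp: algebra_simps case_prod_unfold)

lemma has_grad_const: "has_grad b (\<lambda>z. c) (\<lambda>z. 0) (\<lambda>z. 0)"
  unfolding has_grad_def by (auto simp: case_prod_unfold)

lemma Ck2_const: "Ck2 k b (\<lambda>z. c)"
proof (induction k arbitrary: c)
  case (Suc k)
  then show ?case unfolding Ck2.simps by (intro exI conjI) (rule has_grad_const)
qed simp

lemma Ck2_Suc_imp: "Ck2 (Suc k) b F \<Longrightarrow> Ck2 k b F"
proof (induction k arbitrary: F)
  case 0 then show ?case using has_grad_continuous_on by auto
next
  case (Suc k)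
  then obtain Fu Fv where "has_grad b F Fu Fv" "Ck2 (Suc k) b Fu" "Ck2 (Suc k) b Fv"
    by (metis Ck2.simps(2))
  then show ?case using Suc.IH by (metis Ck2.simps(2))
qed

lemma Ck2_add: "Ck2 k b F \<Longrightarrow> Ck2 k b G \<Longrightarrow> Ck2 k b (\<lambda>z. F z + G z)"
proof (induction k arbitrary: F G)
  case 0 then show ?case by (simp add: continuous_on_add)
next
  case (Suc k)
  obtain Fu Fv Gu Gv where F: "has_grad b F Fu Fv" "Ck2 k b Fu" "Ck2 k b Fv"
    and G: "has_grad b G Gu Gv" "Ck2 k b Gu" "Ck2 k b Gv" using Suc.prems by auto
  then have "Ck2 k b (\<lambda>z. Fu z + Gu z)" "Ck2 k b (\<lambda>z. Fv z + Gv z)" by (auto intro: Suc.IH)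
  then show ?case using has_grad_add[OF F(1) G(1)] by auto
qed

lemma Ck2_mult: "Ck2 k b F \<Longrightarrow> Ck2 k b G \<Longrightarrow> Ck2 k b (\<lambda>z. F z * G z)"
proof (induction k arbitrary: F G)
  case 0 then show ?case by (simp add: continuous_on_mult)
next
  case (Suc k)
  obtain Fu Fv Gu Gv where F: "has_grad b F Fu Fv" "Ck2 k b Fu" "Ck2 k b Fv"
    and G: "has_grad b G Gu Gv" "Ck2 k b Gu" "Ck2 k b Gv" using Suc.prems by auto
  have "Ck2 k b F" "Ck2 k b G" using Suc.prems Ck2_Suc_imp by blast+
  then have "Ck2 k b (\<lambda>z. F z * Gu z + Fu z * G z)" "Ck2 k b (\<lambda>z. F z * Gv z + Fv z * G z)"
    using F G by (auto intro!: Ck2_add Suc.IH)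
  then show ?case using has_grad_mult[OF F(1) G(1)] by auto
qed

lemma Ck2_linear:
  assumes "Ck_on k g UNIV"
  shows "Ck2 k b (\<lambda>z. g (m * fst z + n * snd z))"
  using assms
proof (induction k arbitrary: g)
  case 0
  then show ?case by (auto intro!: continuous_on_compose2[of UNIV g] continuous_intros)
next
  case (Suc k)
  then obtain g' where der: "\<And>x. (g has_vector_derivative g' x) (at x)" and g': "Ck_on k g' UNIV" by auto
  have "has_grad b (\<lambda>z. g (m * fst z + n * snd z)) (\<lambda>z. of_real m * g' (m * fst z + n * snd z))
     (\<lambda>z. of_real n * g' (m * fst z + n * snd z))"
    unfolding has_grad_def
  proof
    fix z :: "real \<times> real"
    have "((\<lambda>z. m * fst z + n * snd z) has_derivative (\<lambda>h. m * fst h + n * snd h)) (at z within square b)"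
      by (auto intro!: derivative_eq_intros)
    from has_derivative_in_compose[OF this, of g "\<lambda>h. h *\<^sub>R g' (m * fst z + n * snd z)"]
    show "((\<lambda>z. g (m * fst z + n * snd z)) has_derivative
       (\<lambda>(h, l). h *\<^sub>R (of_real m * g' (m * fst z + n * snd z)) + l *\<^sub>R (of_real n * g' (m * fst z + n * snd z))))
       (at z within square b)"
      using der by (simp add: has_vector_derivative_def has_derivative_at_withinI case_prod_unfold
          scaleR_left_distrib scaleR_conv_of_real algebra_simps)
  qed
  then show ?case using Suc.IH[OF g'] Ck2_mult[OF Ck2_const] by (simp del: scaleR_conv_of_real) blast
qed

text \<open>
  Restriction to the lines t \<mapsto> (m t, n t); the anti-diagonal, where x = u + v = 0, is
  the case of interest.
\<close>
lemma Ck_on_line: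
  assumes "Ck2 k b F" and st: "\<bar>m\<bar> \<le> 1" "\<bar>n\<bar> \<le> 1"
  shows "Ck_on k (\<lambda>t. F (m * t, n * t)) {-b..b}"
proof -
  have sub: "m * t \<in> {-b..b} \<and> n * t \<in> {-b..b}" if "t \<in> {-b..b}" for t
  proof -
    have "\<bar>m * t\<bar> \<le> 1 * b" "\<bar>n * t\<bar> \<le> 1 * b" unfolding abs_mult using that st by (intro mult_mono; auto)+
    then show ?thesis by auto
  qed
  show ?thesis using assms(1)
  proof (induction k arbitrary: F)
    case 0
    have "continuous_on {-b..b} (\<lambda>t. (m * t, n * t))" by (intro continuous_intros)
    moreover have "(\<lambda>t. (m * t, n * t)) ` {-b..b} \<subseteq> square b" using sub by blast
    ultimately show ?case using continuous_on_compose2[of "square b" F "{-b..b}" "\<lambda>t. (m * t, n * t)"] 0 by simp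
  next
    case (Suc k)
    then obtain Fu Fv where F: "has_grad b F Fu Fv" "Ck2 k b Fu" "Ck2 k b Fv" by auto
    have "((\<lambda>t. F (m * t, n * t)) has_vector_derivative m *\<^sub>R Fu (m * t, n * t) + n *\<^sub>R Fv (m * t, n * t)) (at t within {-b..b})"
      if t: "t \<in> {-b..b}" for t
    proof (rule has_grad_path[OF F(1) _ t])
      show "((\<lambda>t. (m * t, n * t)) has_vector_derivative (m, n)) (at t within {-b..b})"
        unfolding has_vector_derivative_def by (auto intro!: derivative_eq_intros simp: fun_eq_iff mult.commute)
      show "(\<lambda>t. (m * t, n * t)) ` {-b..b} \<subseteq> square b" using sub by auto
    qed
    moreover have "Ck_on k (\<lambda>t. m *\<^sub>R Fu (m * t, n * t) + n *\<^sub>R Fv (m * t, n * t)) {-b..b}"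
      using Suc.IH[OF Ck2_add[OF Ck2_mult[OF Ck2_const F(2)] Ck2_mult[OF Ck2_const F(3)], of "of_real m" "of_real n"]]
      by (simp add: scaleR_conv_of_real)
    ultimately show ?case unfolding Ck_on.simps
      by (intro exI[of _ "\<lambda>t. m *\<^sub>R Fu (m * t, n * t) + n *\<^sub>R Fv (m * t, n * t)"] conjI ballI)
  qed
qed

section \<open>The Goursat problem on the square\<close>

definition int1 :: "(real \<times> real \<Rightarrow> complex) \<Rightarrow> real \<times> real \<Rightarrow> complex" where
  "int1 F z = primitive (\<lambda>\<alpha>. F (\<alpha>, snd z)) (fst z)"

definition int2 :: "(real \<times> real \<Rightarrow> complex) \<Rightarrow> real \<times> real \<Rightarrow> complex" where
  "int2 F z = primitive (\<lambda>\<beta>. F (fst z, \<beta>)) (snd z)"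

lemma continuous_on_slice1:
  "continuous_on (square b) F \<Longrightarrow> v \<in> {-b..b} \<Longrightarrow> continuous_on {-b..b} (\<lambda>u. F (u, v))"
  by (auto intro!: continuous_on_compose2[of "square b" F] continuous_intros)

lemma continuous_on_slice2:
  "continuous_on (square b) F \<Longrightarrow> u \<in> {-b..b} \<Longrightarrow> continuous_on {-b..b} (\<lambda>v. F (u, v))"
  by (auto intro!: continuous_on_compose2[of "square b" F] continuous_intros)

lemma continuous_on_int2:
  assumes "continuous_on (square b) F"
  shows "continuous_on (square b) (int2 F)"
  using continuous_on_primitive_param[of "{-b..b}" b "\<lambda>t x. F (t, x)"] assms
  by (simp add: int2_def case_prod_unfold)

lemma continuous_on_int1:
  assumes "continuous_on (square b) F"
  shows "continuous_on (square b) (int1 F)"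
proof -
  have "continuous_on (square b) (\<lambda>z. F (snd z, fst z))"
    by (rule continuous_on_compose2[OF assms]) (auto intro!: continuous_intros)
  from continuous_on_primitive_param[of "{-b..b}" b "\<lambda>t x. F (x, t)"] this
  have "continuous_on (square b) (\<lambda>z. primitive (\<lambda>x. F (x, fst z)) (snd z))"
    by (simp add: case_prod_unfold)
  then have "continuous_on (square b) (\<lambda>z. (\<lambda>z. primitive (\<lambda>x. F (x, fst z)) (snd z)) (snd z, fst z))"
    by (rule continuous_on_compose2) (auto intro!: continuous_intros)
  then show ?thesis by (simp add: int1_def)
qed

text \<open>
  Integration in u: by the fundamental theorem in u and differentiation under the integral in v,
  an integral is differentiable without any differentiability of F in u. This is how the
  regularity of the Goursat solution improves.
\<close>
lemma has_grad_int1: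
  assumes F: "continuous_on (square b) F" and Fv: "continuous_on (square b) Fv"
    and der: "\<And>u v. u \<in> {-b..b} \<Longrightarrow> v \<in> {-b..b} \<Longrightarrow>
      ((\<lambda>v. F (u, v)) has_vector_derivative Fv (u, v)) (at v within {-b..b})"
  shows "has_grad b (int1 F) F (int1 Fv)"
proof (rule has_grad_partialsI)
  fix u v assume uv: "u \<in> {-b..b}" "v \<in> {-b..b}"
  show "((\<lambda>u. int1 F (u, v)) has_vector_derivative F (u, v)) (at u within {-b..b})"
    using primitive_has_vector_derivative[OF continuous_on_slice1[OF F uv(2)] uv(1)] by (simp add: int1_def)
  have "continuous_on (square b) (\<lambda>z. Fv (snd z, fst z))"
    by (rule continuous_on_compose2[OF Fv]) (auto intro!: continuous_intros)
  then have c: "continuous_on (square b) (\<lambda>(t, y). Fv (y, t))" by (simp add: case_prod_unfold)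
  show "((\<lambda>v. int1 F (u, v)) has_vector_derivative int1 Fv (u, v)) (at v within {-b..b})"
    unfolding int1_def fst_conv snd_conv
    by (rule primitive_param_has_vector_derivative[where b = b and F = "\<lambda>t y. F (y, t)" and F' = "\<lambda>t y. Fv (y, t)"])
      (use uv der continuous_on_slice1[OF F] c in auto)
qed (rule continuous_on_int1[OF Fv])

lemma has_grad_int2:
  assumes F: "continuous_on (square b) F" and Fu: "continuous_on (square b) Fu"
    and der: "\<And>u v. u \<in> {-b..b} \<Longrightarrow> v \<in> {-b..b} \<Longrightarrow>
      ((\<lambda>u. F (u, v)) has_vector_derivative Fu (u, v)) (at u within {-b..b})"
  shows "has_grad b (int2 F) (int2 Fu) F"
proof (rule has_grad_partialsI)
  fix u v assume uv: "u \<in> {-b..b}" "v \<in> {-b..b}"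
  show "((\<lambda>v. int2 F (u, v)) has_vector_derivative F (u, v)) (at v within {-b..b})"
    using primitive_has_vector_derivative[OF continuous_on_slice2[OF F uv(1)] uv(2)] by (simp add: int2_def)
  have c: "continuous_on (square b) (\<lambda>(t, y). Fu (t, y))" using Fu by simp
  show "((\<lambda>u. int2 F (u, v)) has_vector_derivative int2 Fu (u, v)) (at u within {-b..b})"
    unfolding int2_def fst_conv snd_conv
    by (rule primitive_param_has_vector_derivative[where b = b and F = "\<lambda>t y. F (t, y)" and F' = "\<lambda>t y. Fu (t, y)"])
      (use uv der continuous_on_slice2[OF F] c in auto)
qed (rule F)

lemma Ck2_int1: "Ck2 k b F \<Longrightarrow> Ck2 k b (int1 F)"
proof (induction k arbitrary: F)
  case 0 then show ?case by (simp add: continuous_on_int1)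
next
  case (Suc k)
  then obtain Fu Fv where F: "has_grad b F Fu Fv" "Ck2 k b Fv" by auto
  have "has_grad b (int1 F) F (int1 Fv)"
    by (intro has_grad_int1 has_grad_continuous_on[OF F(1)] Ck2_continuous_on[OF F(2)] has_grad_partials(2)[OF F(1)])
  then show ?case using Suc.IH[OF F(2)] Ck2_Suc_imp[OF Suc.prems] by auto
qed

lemma Ck2_int2: "Ck2 k b F \<Longrightarrow> Ck2 k b (int2 F)"
proof (induction k arbitrary: F)
  case 0 then show ?case by (simp add: continuous_on_int2)
next
  case (Suc k)
  then obtain Fu Fv where F: "has_grad b F Fu Fv" "Ck2 k b Fu" by auto
  have "has_grad b (int2 F) (int2 Fu) F"
    by (intro has_grad_int2 has_grad_continuous_on[OF F(1)] Ck2_continuous_on[OF F(2)] has_grad_partials(1)[OF F(1)])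
  then show ?case using Suc.IH[OF F(2)] Ck2_Suc_imp[OF Suc.prems] by auto
qed

text \<open>
  Existence for the Volterra form of the Goursat problem by Banach's fixed point theorem. The
  operator is conjugated with the weight exp (lam |u|): the integration in u then has norm at
  most 1 / lam, the one in v at most b, so lam = 2 b Q + 1 makes it a contraction with factor
  1/2. Functions on the square are turned into bounded functions on the plane by composing with
  the projection onto the square.
\<close>
lemma goursat_fixed_point:
  fixes q a :: "real \<Rightarrow> complex"
  assumes b: "b > 0" and q: "continuous_on UNIV q" and a: "continuous_on {-b..b} a"
  obtains H where "continuous_on (square b) H"
    and "\<And>z. z \<in> square b \<Longrightarrow> H z = a (fst z) + int2 (int1 (\<lambda>w. q (fst w + snd w) * H w)) z"
proof -
  have "compact (q ` {-2*b..2*b})"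
    by (intro compact_continuous_image continuous_on_subset[OF q]) auto
  from compact_imp_bounded[OF this] obtain Q0 where Q0: "\<And>s. s \<in> {-2*b..2*b} \<Longrightarrow> norm (q s) \<le> Q0"
    unfolding bounded_iff by blast
  define Q where "Q = max Q0 0"
  have Q: "Q \<ge> 0" "\<And>s. s \<in> {-2*b..2*b} \<Longrightarrow> norm (q s) \<le> Q" using Q0 by (auto simp: Q_def le_max_iff_disj)
  define lam where "lam = 2 * b * Q + 1"
  have lam: "lam > 0" "b * Q / lam \<le> 1 / 2" using b Q(1) by (auto simp: lam_def add_nonneg_pos divide_simps)
  define E where "E z = complex_of_real (exp (lam * \<bar>fst z\<bar>))" for z :: "real \<times> real"
  have E0: "E z \<noteq> 0" for z by (simp add: E_def)
  have contE: "continuous_on S E" for S unfolding E_def by (intro continuous_intros)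
  define P where "P G w = q (fst w + snd w) * (E w * G w)" for G and w :: "real \<times> real"
  have contP: "continuous_on (square b) (P G)" if "continuous_on (square b) G" for G
    unfolding P_def by (intro continuous_intros contE that continuous_on_compose2[OF q]) auto
  define T where "T G z = (a (fst z) + int2 (int1 (P G)) z) / E z" for G and z :: "real \<times> real"
  have contT: "continuous_on (square b) (T G)" if "continuous_on (square b) G" for G
    unfolding T_def
    by (intro continuous_intros contE continuous_on_int2 continuous_on_int1 contP that
        continuous_on_compose2[OF a]) (auto simp: E0)
  have sq: "square b = cbox (-b, -b) (b, b)" by (simp add: cbox_Pair_eq)
  have "\<exists>g::(real \<times> real) \<Rightarrow>\<^sub>C complex. (\<forall>x\<in>square b. g x = T (apply_bcontfun G) x) \<and>
      (\<forall>x. g x = T (apply_bcontfun G) (clamp (-b, -b) (b, b) x))" for G :: "(real \<times> real) \<Rightarrow>\<^sub>C complex"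
  proof -
    have "continuous_on (cbox (-b, -b) (b, b)) (T (apply_bcontfun G))"
      using contT[of "apply_bcontfun G"] sq by simp
    then obtain g :: "(real \<times> real) \<Rightarrow>\<^sub>C complex"
      where "\<And>x. x \<in> cbox (-b, -b) (b, b) \<Longrightarrow> g x = T (apply_bcontfun G) x"
        "\<And>x. g x = T (apply_bcontfun G) (clamp (-b, -b) (b, b) x)"
      by (rule continuous_on_cbox_bcontfunE) (rule that)
    then show ?thesis unfolding sq by (intro exI[of _ g] conjI ballI allI)
  qed
  then have "\<forall>G. \<exists>g::(real \<times> real) \<Rightarrow>\<^sub>C complex. (\<forall>x\<in>square b. g x = T (apply_bcontfun G) x) \<and>
      (\<forall>x. g x = T (apply_bcontfun G) (clamp (-b, -b) (b, b) x))" by (rule allI)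
  from choice[OF this] obtain \<Phi> :: "((real \<times> real) \<Rightarrow>\<^sub>C complex) \<Rightarrow> ((real \<times> real) \<Rightarrow>\<^sub>C complex)"
    where \<Phi>0: "\<forall>G. (\<forall>x\<in>square b. \<Phi> G x = T (apply_bcontfun G) x) \<and>
      (\<forall>x. \<Phi> G x = T (apply_bcontfun G) (clamp (-b, -b) (b, b) x))" ..
  have \<Phi>: "\<Phi> G x = T (apply_bcontfun G) x" if "x \<in> square b" for G x
    using \<Phi>0 that by blast
  have \<Phi>c: "\<Phi> G x = T (apply_bcontfun G) (clamp (-b, -b) (b, b) x)" for G x
    using \<Phi>0 by blast
  have contract: "dist (\<Phi> G1) (\<Phi> G2) \<le> 1 / 2 * dist G1 G2" for G1 G2
  proof (rule dist_bound)
    fix x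
    define z where "z = clamp (-b, -b) (b, b) x"
    have "z \<in> cbox (-b, -b) (b, b)"
      unfolding z_def using b by (intro clamp_in_interval) (auto simp: Basis_prod_def)
    then have z: "z \<in> square b" by (simp add: sq)
    define u v where "u = fst z" and "v = snd z"
    have uv: "u \<in> {-b..b}" "v \<in> {-b..b}" "z = (u, v)" using z by (auto simp: u_def v_def)
    have c1: "continuous_on (square b) (P (apply_bcontfun G))" for G :: "(real \<times> real) \<Rightarrow>\<^sub>C complex"
      by (rule contP) simp
    have inner: "norm (int1 (P G1) (u, \<beta>) - int1 (P G2) (u, \<beta>)) \<le> Q * dist G1 G2 / lam * exp (lam * \<bar>u\<bar>)"
      if \<beta>: "\<beta> \<in> {-b..b}" for \<beta>
    proof -
      have c: "continuous_on {-b..b} (\<lambda>\<alpha>. P (apply_bcontfun G) (\<alpha>, \<beta>))" for G :: "(real \<times> real) \<Rightarrow>\<^sub>C complex"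
        by (rule continuous_on_slice1[OF c1 \<beta>])
      have "norm (primitive (\<lambda>\<alpha>. P G1 (\<alpha>, \<beta>) - P G2 (\<alpha>, \<beta>)) u) \<le> Q * dist G1 G2 / lam * exp (lam * \<bar>u\<bar>)"
      proof (rule primitive_weighted_bound[OF _ uv(1) lam(1)])
        show "continuous_on {-b..b} (\<lambda>\<alpha>. P G1 (\<alpha>, \<beta>) - P G2 (\<alpha>, \<beta>))" by (intro continuous_intros c)
        show "0 \<le> Q * dist G1 G2" using Q(1) by simp
        fix \<alpha> assume \<alpha>: "\<alpha> \<in> {-b..b}"
        have "P G1 (\<alpha>, \<beta>) - P G2 (\<alpha>, \<beta>) = q (\<alpha> + \<beta>) * (G1 (\<alpha>, \<beta>) - G2 (\<alpha>, \<beta>)) * E (\<alpha>, \<beta>)"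
          by (simp add: P_def algebra_simps)
        also have "norm \<dots> \<le> Q * dist G1 G2 * exp (lam * \<bar>\<alpha>\<bar>)"
          unfolding norm_mult using \<alpha> \<beta> dist_bounded[of G1 "(\<alpha>, \<beta>)" G2] Q(1)
          by (intro mult_mono Q(2)) (auto simp: E_def dist_norm)
        finally show "norm (P G1 (\<alpha>, \<beta>) - P G2 (\<alpha>, \<beta>)) \<le> Q * dist G1 G2 * exp (lam * \<bar>\<alpha>\<bar>)" .
      qed
      then show ?thesis by (simp add: int1_def primitive_diff[OF c c uv(1)])
    qed
    have c2: "continuous_on {-b..b} (\<lambda>\<beta>. int1 (P (apply_bcontfun G)) (u, \<beta>))" for G :: "(real \<times> real) \<Rightarrow>\<^sub>C complex"
      by (rule continuous_on_slice2[OF continuous_on_int1[OF c1] uv(1)])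
    have "norm (primitive (\<lambda>\<beta>. int1 (P G1) (u, \<beta>) - int1 (P G2) (u, \<beta>)) v) \<le> \<bar>v\<bar> * (Q * dist G1 G2 / lam * exp (lam * \<bar>u\<bar>))"
      by (rule primitive_bound[OF _ uv(2) inner]) (intro continuous_intros c2)
    also have "\<dots> \<le> b * (Q * dist G1 G2 / lam * exp (lam * \<bar>u\<bar>))"
      using uv Q(1) lam(1) by (intro mult_right_mono) auto
    finally have "norm (int2 (int1 (P G1)) z - int2 (int1 (P G2)) z) \<le> b * (Q * dist G1 G2 / lam * exp (lam * \<bar>u\<bar>))"
      by (simp add: int2_def uv(3) primitive_diff[OF c2 c2 uv(2)])
    then have "norm ((int2 (int1 (P G1)) z - int2 (int1 (P G2)) z) / E z) \<le> b * (Q * dist G1 G2 / lam)"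
      by (simp add: norm_divide E_def uv(3) pos_divide_le_eq)
    also have "\<dots> = (b * Q / lam) * dist G1 G2" by simp
    also have "\<dots> \<le> 1 / 2 * dist G1 G2" by (intro mult_right_mono lam) auto
    finally show "dist (\<Phi> G1 x) (\<Phi> G2 x) \<le> 1 / 2 * dist G1 G2"
      unfolding \<Phi>c z_def[symmetric] dist_norm by (simp add: T_def diff_divide_distrib add_divide_distrib)
  qed
  have "\<exists>!G. \<Phi> G = G" by (rule banach_fix_type[of "1/2"]) (auto intro: contract[simplified])
  then obtain G where G: "\<Phi> G = G" by blast
  define H where "H z = E z * G z" for z
  have PH: "P (apply_bcontfun G) = (\<lambda>w. q (fst w + snd w) * H w)" by (simp add: P_def H_def fun_eq_iff)
  show ?thesis
  proof
    show "continuous_on (square b) H" unfolding H_def by (intro continuous_intros contE) simp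
    fix z assume z: "z \<in> square b"
    have "G z = T G z" using \<Phi>[OF z, of G] G by simp
    then show "H z = a (fst z) + int2 (int1 (\<lambda>w. q (fst w + snd w) * H w)) z"
      unfolding PH[symmetric] by (simp add: H_def T_def E0)
  qed
qed

lemma Ck_on_antiderivative:
  assumes "Ck_on k g UNIV"
  obtains G where "\<And>x. (G has_vector_derivative g x) (at x)" "G x0 = y0" "Ck_on (Suc k) G UNIV"
proof -
  have "isCont g x" for x
    using Ck_on_continuous_on[OF assms] by (simp add: continuous_on_eq_continuous_at)
  then obtain F where F: "\<And>x. (F has_vector_derivative g x) (at x)"
    using einterval_antiderivative[of "-\<infinity>" "\<infinity>" g] by auto
  let ?G = "\<lambda>x. F x - F x0 + y0"
  have "(?G has_vector_derivative g x) (at x)" for x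
    by (auto intro!: derivative_eq_intros F)
  then show ?thesis using assms by (intro that[of ?G]) auto
qed

text \<open>
  The highest derivative is extended by constants and then integrated back.
\<close>
lemma Ck_on_extension:
  assumes b: "b > 0" and "Ck_on k g {-b..b}"
  shows "\<exists>ge. Ck_on k ge UNIV \<and> (\<forall>x\<in>{-b..b}. ge x = g x)"
  using assms(2)
proof (induction k arbitrary: g)
  case 0
  have "continuous_on UNIV (\<lambda>x. g (max (-b) (min b x)))"
    using 0 b by (auto intro!: continuous_on_compose2[of "{-b..b}" g] continuous_intros)
  then show ?case by (intro exI[of _ "\<lambda>x. g (max (-b) (min b x))"]) auto
next
  case (Suc k)
  then obtain g' where der: "\<And>x. x \<in> {-b..b} \<Longrightarrow> (g has_vector_derivative g' x) (at x within {-b..b})"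
    and g': "Ck_on k g' {-b..b}" unfolding Ck_on.simps by blast
  obtain ge' where ge': "Ck_on k ge' UNIV" "\<And>x. x \<in> {-b..b} \<Longrightarrow> ge' x = g' x"
    using Suc.IH[OF g'] by blast
  obtain ge where ge: "\<And>x. (ge has_vector_derivative ge' x) (at x)" "ge 0 = g 0" "Ck_on (Suc k) ge UNIV"
    using Ck_on_antiderivative[OF ge'(1), of 0 "g 0"] by metis
  have "ge x = g x" if x: "x \<in> {-b..b}" for x
  proof -
    have "\<exists>c. \<forall>x\<in>{-b..b}. ge x - g x = c"
    proof (rule has_vector_derivative_zero_constant)
      show "((\<lambda>x. ge x - g x) has_vector_derivative 0) (at x within {-b..b})" if "x \<in> {-b..b}" for x
        using has_vector_derivative_diff[OF has_vector_derivative_at_within[OF ge(1)] der[OF that]] ge'(2)[OF that]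
        by simp
    qed auto
    then obtain c where "\<And>x. x \<in> {-b..b} \<Longrightarrow> ge x - g x = c" by blast
    from this[of 0] this[OF x] b ge(2) show ?thesis by simp
  qed
  then show ?case using ge(3) by blast
qed

text \<open>
  The solution H = a + int2 (int1 (q H)) gains one derivative over q. Both partial derivatives
  of H, namely q / 2 + int2 (q H) and int1 (q H), are as smooth as q and H allow, and so H
  climbs from class C^k to class C^(k+1) as long as k \<le> p. The solution lives on the whole
  square |u|, |v| \<le> b, where u + v ranges over [-2 b, 2 b]; this is why q has to be defined,
  and smooth, beyond [-b, b].
\<close>
lemma goursat_smooth_solution:
  assumes b: "b > 0" and q: "Ck_on p q UNIV"
  obtains H Hv a where
    "Ck2 (Suc p) b (H :: real \<times> real \<Rightarrow> complex)" "Ck2 p b Hv"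
    and "\<And>u v. u \<in> {-b..b} \<Longrightarrow> v \<in> {-b..b} \<Longrightarrow>
      ((\<lambda>v. H (u, v)) has_vector_derivative Hv (u, v)) (at v within {-b..b})"
    and "\<And>u v. u \<in> {-b..b} \<Longrightarrow> v \<in> {-b..b} \<Longrightarrow>
      ((\<lambda>u. Hv (u, v)) has_vector_derivative q (u + v) * H (u, v)) (at u within {-b..b})"
    and "\<And>x. (a has_vector_derivative q x / 2) (at x)" "a 0 = c"
    and "\<And>u. u \<in> {-b..b} \<Longrightarrow> H (u, 0) = a u"
    and "\<And>v. v \<in> {-b..b} \<Longrightarrow> H (0, v) = c"
proof -
  obtain A where A: "\<And>x. (A has_vector_derivative q x) (at x)" "A 0 = 2 * c"
    using Ck_on_antiderivative[OF q, of 0 "2 * c"] by metis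
  define a where "a x = A x / 2" for x
  have da: "(a has_vector_derivative q x / 2) (at x)" for x
    unfolding a_def by (rule has_vector_derivative_divide[OF A(1)])
  have a0: "a 0 = c" by (simp add: a_def A)
  have qc: "continuous_on UNIV q" by (rule Ck_on_continuous_on[OF q])
  have "continuous_on {-b..b} a"
    by (intro continuous_at_imp_continuous_on ballI has_vector_derivative_continuous[OF da])
  from goursat_fixed_point[OF b qc this] obtain H where cH: "continuous_on (square b) H"
    and H: "\<And>z. z \<in> square b \<Longrightarrow> H z = a (fst z) + int2 (int1 (\<lambda>w. q (fst w + snd w) * H w)) z" by blast
  define P where "P = (\<lambda>w. q (fst w + snd w) * H w)"
  have Cq: "Ck2 p b (\<lambda>w. q (fst w + snd w))" using Ck2_linear[OF q, of b 1 1] by simp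
  have cP: "continuous_on (square b) P"
    unfolding P_def using Ck2_mult[of 0] cH Ck2_continuous_on[OF Cq] by simp
  have dP: "((\<lambda>u. int1 P (u, v)) has_vector_derivative P (u, v)) (at u within {-b..b})"
    if "u \<in> {-b..b}" "v \<in> {-b..b}" for u v
    using primitive_has_vector_derivative[OF continuous_on_slice1[OF cP that(2)] that(1)] by (simp add: int1_def)
  have g1: "has_grad b (int2 (int1 P)) (int2 P) (int1 P)"
    by (intro has_grad_int2 continuous_on_int1 cP dP)
  have "has_grad b (\<lambda>z. a (fst z)) (\<lambda>z. q (fst z) / 2) (\<lambda>z. 0)"
  proof (rule has_grad_partialsI)
    show "((\<lambda>u. a (fst (u, v))) has_vector_derivative q (fst (u, v)) / 2) (at u within {-b..b})" for u v :: real
      by (simp add: has_vector_derivative_at_within da)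
  qed auto
  from has_grad_add[OF this g1]
  have g2: "has_grad b (\<lambda>z. a (fst z) + int2 (int1 P) z) (\<lambda>z. q (fst z) / 2 + int2 P z) (int1 P)" by simp
  have gH: "has_grad b H (\<lambda>z. q (fst z) / 2 + int2 P z) (int1 P)"
    unfolding has_grad_def
  proof
    fix z assume z: "z \<in> square b"
    from g2 z have "((\<lambda>z. a (fst z) + int2 (int1 P) z) has_derivative
       (\<lambda>(h, l). h *\<^sub>R (q (fst z) / 2 + int2 P z) + l *\<^sub>R int1 P z)) (at z within square b)"
      unfolding has_grad_def by blast
    then show "(H has_derivative (\<lambda>(h, l). h *\<^sub>R (q (fst z) / 2 + int2 P z) + l *\<^sub>R int1 P z)) (at z within square b)"
      by (rule has_derivative_transform[OF z, rotated]) (simp add: H P_def)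
  qed
  have Ca: "Ck2 p b (\<lambda>z. q (fst z) / 2)"
    using Ck2_mult[OF Ck2_linear[OF q, of b 1 0] Ck2_const[of p b "1/2"]] by simp
  have Cmono: "Ck2 j b F" if "Ck2 k b F" "j \<le> k" for j k F
    using that(2,1) by (induction rule: inc_induct) (auto simp del: Ck2.simps intro: Ck2_Suc_imp)
  have CH: "Ck2 k b H" if "k \<le> Suc p" for k using that
  proof (induction k)
    case 0 then show ?case using cH by simp
  next
    case (Suc k)
    then have "Ck2 k b P" unfolding P_def by (intro Ck2_mult Cmono[OF Cq]) auto
    then show ?case using gH Suc.prems
      by (auto intro!: exI Ck2_add Cmono[OF Ca] Ck2_int1 Ck2_int2)
  qed
  have "Ck2 p b P" unfolding P_def by (intro Ck2_mult Cq CH) auto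
  then have "Ck2 p b (int1 P)" by (rule Ck2_int1)
  moreover have "H (u, 0) = a u" if "u \<in> {-b..b}" for u
    using that b H[of "(u, 0)"] by (simp add: int2_def)
  moreover have "H (0, v) = c" if "v \<in> {-b..b}" for v
    using that b H[of "(0, v)"] a0 by (simp add: int2_def int1_def primitive_def)
  ultimately show ?thesis
    using CH[OF order_refl] dP has_grad_partials(2)[OF gH] da a0
    by (intro that[of H "int1 P" a]) (auto simp: P_def simp del: Ck2.simps)
qed

section \<open>Stability and uniqueness\<close>

text \<open>
  The points of the square with |x| \<le> b, where x = u + v. Together with (u, v) it contains
  the characteristic triangle cut off by the line u + v = 0, and it contains the set |u| + |v|
  \<le> b on which the kernel is given.
\<close>
definition hexagon :: "real \<Rightarrow> (real \<times> real) set" where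
  "hexagon b = {(u, v). u \<in> {-b..b} \<and> v \<in> {-b..b} \<and> u + v \<in> {-b..b}}"

lemma compact_hexagon: "compact (hexagon b)"
proof -
  have "hexagon b = square b \<inter> {z. -b \<le> fst z + snd z} \<inter> {z. fst z + snd z \<le> b}"
    by (auto simp: hexagon_def)
  moreover have "closed {z::real \<times> real. -b \<le> fst z + snd z}" "closed {z::real \<times> real. fst z + snd z \<le> b}"
    by (intro closed_Collect_le continuous_intros)+
  ultimately show ?thesis by (auto intro!: compact_Int_closed compact_Times)
qed

text \<open>
  Stability of the Cauchy problem on the line u + v = 0 for the equation E_uv = q E. The data
  are the values E (u, - u) and, in place of the normal derivative, an antiderivative \<Psi> of
  E_v - h E along that line; measuring the second datum after integration is what avoids losing
  a derivative. Let M be the maximum of |E| exp (- lam |u + v|). Integrating q E from the line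
  in the direction u and the result in the direction v gives |E| \<le> d + 2 e + (Q M / lam +
  |h| d) / lam * exp (lam |u + v|), and for lam = 2 Q + 1 the term with M is absorbed.
\<close>
lemma cauchy_stability:
  fixes E Ev :: "real \<times> real \<Rightarrow> complex" and q \<Psi> :: "real \<Rightarrow> complex"
  assumes b: "b > 0" and Q: "\<And>x. x \<in> {-b..b} \<Longrightarrow> norm (q x) \<le> Q"
    and cont: "continuous_on (hexagon b) E"
    and dv: "\<And>u v. (u, v) \<in> hexagon b \<Longrightarrow>
      ((\<lambda>w. E (u, w)) has_vector_derivative Ev (u, v)) (at v within {w. (u, w) \<in> hexagon b})"
    and du: "\<And>u v. (u, v) \<in> hexagon b \<Longrightarrow>
      ((\<lambda>w. Ev (w, v)) has_vector_derivative q (u + v) * E (u, v)) (at u within {w. (w, v) \<in> hexagon b})"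
    and E0: "\<And>u. u \<in> {-b..b} \<Longrightarrow> norm (E (u, - u)) \<le> d"
    and d\<Psi>: "\<And>s. s \<in> {-b..b} \<Longrightarrow>
      (\<Psi> has_vector_derivative Ev (- s, s) - h * E (- s, s)) (at s within {-b..b})"
    and \<Psi>: "\<And>s. s \<in> {-b..b} \<Longrightarrow> norm (\<Psi> s) \<le> e"
    and z: "z \<in> hexagon b"
  shows "norm (E z) \<le> 2 * ((1 + norm h) * d + 2 * e) * exp ((2 * Q + 1) * b)"
proof -
  have Q0: "Q \<ge> 0" using Q[of 0] b norm_ge_zero[of "q 0"] by (simp del: norm_ge_zero)
  have d0: "d \<ge> 0" using E0[of 0] b norm_ge_zero[of "E (0, -0)"] by (simp del: norm_ge_zero)
  have e0: "e \<ge> 0" using \<Psi>[of 0] b norm_ge_zero[of "\<Psi> 0"] by (simp del: norm_ge_zero)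
  define lam where "lam = 2 * Q + 1"
  have lam: "lam \<ge> 1" using Q0 by (simp add: lam_def)
  have "Q / lam / lam \<le> Q / lam" using lam Q0 mult_left_mono[of 1 lam Q] by (simp add: divide_simps)
  also have "\<dots> \<le> 1 / 2" using Q0 by (simp add: lam_def divide_simps)
  finally have Qlam: "Q / lam / lam \<le> 1 / 2" .
  have "\<exists>z0\<in>hexagon b. \<forall>z\<in>hexagon b.
      norm (E z) * exp (- (lam * \<bar>fst z + snd z\<bar>)) \<le> norm (E z0) * exp (- (lam * \<bar>fst z0 + snd z0\<bar>))"
    using z by (intro continuous_attains_sup compact_hexagon continuous_intros cont) auto
  then obtain z0 where z0': "z0 \<in> hexagon b"
    and max': "\<And>z. z \<in> hexagon b \<Longrightarrow> norm (E z) * exp (- (lam * \<bar>fst z + snd z\<bar>))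
        \<le> norm (E z0) * exp (- (lam * \<bar>fst z0 + snd z0\<bar>))" by blast
  obtain u0 v0 where uv0: "z0 = (u0, v0)" by fastforce
  have z0: "(u0, v0) \<in> hexagon b" using z0' uv0 by simp
  have max: "norm (E z) * exp (- (lam * \<bar>fst z + snd z\<bar>)) \<le> norm (E (u0, v0)) * exp (- (lam * \<bar>u0 + v0\<bar>))"
    if "z \<in> hexagon b" for z using max'[OF that] by (simp add: uv0)
  define M where "M = norm (E (u0, v0)) * exp (- (lam * \<bar>u0 + v0\<bar>))"
  have M0: "M \<ge> 0" by (simp add: M_def)
  have bndE: "norm (E (u, v)) \<le> M * exp (lam * \<bar>u + v\<bar>)" if "(u, v) \<in> hexagon b" for u v
    using max[OF that] unfolding M_def[symmetric] by (simp add: exp_minus divide_simps)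
  have seg: "(u, \<beta>) \<in> hexagon b" if "(u, v) \<in> hexagon b" "\<beta> \<in> closed_segment (-u) v" for u v \<beta>
    using that by (auto simp: hexagon_def closed_segment_eq_real_ivl split: if_splits)
  have seg': "(\<alpha>, \<beta>) \<in> hexagon b" if "(u, \<beta>) \<in> hexagon b" "\<alpha> \<in> closed_segment (-\<beta>) u" for u \<alpha> \<beta>
    using that by (auto simp: hexagon_def closed_segment_eq_real_ivl split: if_splits)
  have inner: "norm (Ev (u, \<beta>) - Ev (- \<beta>, \<beta>)) \<le> Q * M / lam * exp (lam * \<bar>\<beta> - (-u)\<bar>)"
    if u\<beta>: "(u, \<beta>) \<in> hexagon b" for u \<beta>
  proof -
    have "norm (Ev (u, \<beta>) - Ev (- \<beta>, \<beta>)) \<le> Q * M / lam * exp (lam * \<bar>u - (- \<beta>)\<bar>)"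
    proof (rule weighted_increment_bound[where y = "\<lambda>\<alpha>. Ev (\<alpha>, \<beta>)" and y' = "\<lambda>\<alpha>. q (\<alpha> + \<beta>) * E (\<alpha>, \<beta>)"])
      fix \<alpha> assume \<alpha>: "\<alpha> \<in> closed_segment (- \<beta>) u"
      have \<alpha>\<beta>: "(\<alpha>, \<beta>) \<in> hexagon b" by (rule seg'[OF u\<beta> \<alpha>])
      show "((\<lambda>\<alpha>. Ev (\<alpha>, \<beta>)) has_vector_derivative q (\<alpha> + \<beta>) * E (\<alpha>, \<beta>)) (at \<alpha> within closed_segment (- \<beta>) u)"
        by (rule has_vector_derivative_within_subset[OF du[OF \<alpha>\<beta>]]) (use seg'[OF u\<beta>] in auto)
      have "norm (q (\<alpha> + \<beta>) * E (\<alpha>, \<beta>)) \<le> Q * (M * exp (lam * \<bar>\<alpha> + \<beta>\<bar>))"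
        unfolding norm_mult using \<alpha>\<beta> Q0 by (intro mult_mono Q bndE) (auto simp: hexagon_def)
      then show "norm (q (\<alpha> + \<beta>) * E (\<alpha>, \<beta>)) \<le> Q * M * exp (lam * \<bar>\<alpha> - (- \<beta>)\<bar>)" by (simp add: mult.assoc)
    qed (use lam Q0 M0 in auto)
    then show ?thesis by (simp add: add.commute)
  qed
  have main: "norm (E (u, v)) \<le> d + 2 * e + (Q * M / lam + norm h * d) / lam * exp (lam * \<bar>u + v\<bar>)"
    if uv: "(u, v) \<in> hexagon b" for u v
  proof -
    have u: "u \<in> {-b..b}" "v \<in> {-b..b}" using uv by (auto simp: hexagon_def)
    let ?y = "\<lambda>\<beta>. E (u, \<beta>) - \<Psi> \<beta>"
    have "norm (?y v - ?y (-u)) \<le> (Q * M / lam + norm h * d) / lam * exp (lam * \<bar>v - (-u)\<bar>)"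
    proof (rule weighted_increment_bound[where y' = "\<lambda>\<beta>. Ev (u, \<beta>) - (Ev (- \<beta>, \<beta>) - h * E (- \<beta>, \<beta>))"])
      fix \<beta> assume \<beta>: "\<beta> \<in> closed_segment (- u) v"
      have u\<beta>: "(u, \<beta>) \<in> hexagon b" by (rule seg[OF uv \<beta>])
      then have \<beta>b: "\<beta> \<in> {-b..b}" by (auto simp: hexagon_def)
      show "(?y has_vector_derivative Ev (u, \<beta>) - (Ev (- \<beta>, \<beta>) - h * E (- \<beta>, \<beta>))) (at \<beta> within closed_segment (- u) v)"
      proof (rule has_vector_derivative_diff)
        show "((\<lambda>\<beta>. E (u, \<beta>)) has_vector_derivative Ev (u, \<beta>)) (at \<beta> within closed_segment (- u) v)"
          by (rule has_vector_derivative_within_subset[OF dv[OF u\<beta>]]) (use seg[OF uv] in auto)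
        show "(\<Psi> has_vector_derivative Ev (- \<beta>, \<beta>) - h * E (- \<beta>, \<beta>)) (at \<beta> within closed_segment (- u) v)"
          by (rule has_vector_derivative_within_subset[OF d\<Psi>[OF \<beta>b]])
            (use u in \<open>auto simp: closed_segment_eq_real_ivl split: if_splits\<close>)
      qed
      have "norm (h * E (- \<beta>, \<beta>)) \<le> norm h * d"
        unfolding norm_mult using E0[of "-\<beta>"] \<beta>b by (intro mult_left_mono) auto
      moreover have eq: "Ev (u, \<beta>) - (Ev (- \<beta>, \<beta>) - h * E (- \<beta>, \<beta>)) = (Ev (u, \<beta>) - Ev (- \<beta>, \<beta>)) + h * E (- \<beta>, \<beta>)" by simp
      ultimately have "norm (Ev (u, \<beta>) - (Ev (- \<beta>, \<beta>) - h * E (- \<beta>, \<beta>)))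
          \<le> Q * M / lam * exp (lam * \<bar>\<beta> - (-u)\<bar>) + norm h * d * 1"
        using inner[OF u\<beta>] norm_triangle_ineq[of "Ev (u, \<beta>) - Ev (- \<beta>, \<beta>)" "h * E (- \<beta>, \<beta>)"]
        unfolding eq by linarith
      also have "\<dots> \<le> Q * M / lam * exp (lam * \<bar>\<beta> - (-u)\<bar>) + norm h * d * exp (lam * \<bar>\<beta> - (-u)\<bar>)"
        using lam d0 by (intro add_left_mono mult_left_mono) auto
      finally show "norm (Ev (u, \<beta>) - (Ev (- \<beta>, \<beta>) - h * E (- \<beta>, \<beta>)))
          \<le> (Q * M / lam + norm h * d) * exp (lam * \<bar>\<beta> - (-u)\<bar>)" by (simp add: distrib_right)
    qed (use lam Q0 M0 d0 in auto)
    moreover have "E (u, v) = (?y v - ?y (-u)) + \<Psi> v - \<Psi> (-u) + E (u, -u)" by simp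
    moreover have "norm (((?y v - ?y (-u)) + \<Psi> v - \<Psi> (-u)) + E (u, -u))
        \<le> norm (?y v - ?y (-u)) + norm (\<Psi> v) + norm (\<Psi> (-u)) + norm (E (u, -u))"
      by (intro order_trans[OF norm_triangle_ineq] add_mono order_refl
          order_trans[OF norm_triangle_ineq4])
    ultimately show ?thesis using \<Psi>[of v] \<Psi>[of "-u"] E0[of u] u by (simp add: add.commute)
  qed
  have "M \<le> (d + 2 * e + (Q * M / lam + norm h * d) / lam * exp (lam * \<bar>u0 + v0\<bar>)) * exp (- (lam * \<bar>u0 + v0\<bar>))"
    unfolding M_def by (intro mult_right_mono) (use main[OF z0] in \<open>simp_all add: M_def\<close>)
  also have "\<dots> = (d + 2 * e) * exp (- (lam * \<bar>u0 + v0\<bar>)) + (Q / lam / lam * M + norm h * d / lam)"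
    by (simp add: algebra_simps add_divide_distrib flip: exp_add)
  also have "\<dots> \<le> (d + 2 * e) * 1 + (1 / 2 * M + norm h * d / 1)"
    using lam d0 e0 Qlam M0
    by (intro add_mono mult_mono divide_left_mono mult_nonneg_nonneg) auto
  finally have M: "M \<le> 2 * ((1 + norm h) * d + 2 * e)" by (simp add: algebra_simps)
  obtain u v where uv: "z = (u, v)" by fastforce
  have "norm (E z) \<le> M * exp (lam * \<bar>u + v\<bar>)" using bndE z uv by simp
  also have "\<dots> \<le> 2 * ((1 + norm h) * d + 2 * e) * exp (lam * b)"
    using M M0 lam z uv by (intro mult_mono) (auto simp: hexagon_def)
  finally show ?thesis by (simp add: lam_def)
qed

definition open_diamond :: "real \<Rightarrow> (real \<times> real) set" where
  "open_diamond b = {(u, v). \<bar>u + v\<bar> < b \<and> \<bar>u - v\<bar> < b}"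

lemma open_diamond_subset_interior: "open_diamond b \<subseteq> interior (goursat_domain b)"
proof (rule interior_maximal)
  have "open_diamond b = {z. \<bar>fst z + snd z\<bar> < b} \<inter> {z. \<bar>fst z - snd z\<bar> < b}"
    by (auto simp: open_diamond_def)
  then show "open (open_diamond b)"
    by (auto intro!: open_Int open_Collect_less continuous_intros)
qed (auto simp: open_diamond_def goursat_domain_def)

lemma compact_goursat_domain: "compact (goursat_domain b)"
proof -
  have "goursat_domain b = square b \<inter> {z. -b \<le> fst z + snd z} \<inter> {z. fst z + snd z \<le> b}
     \<inter> {z. -b \<le> fst z - snd z} \<inter> {z. fst z - snd z \<le> b}"
    by (auto simp: goursat_domain_def)
  moreover have "closed {z::real \<times> real. -b \<le> fst z + snd z}" "closed {z::real \<times> real. fst z + snd z \<le> b}"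
     "closed {z::real \<times> real. -b \<le> fst z - snd z}" "closed {z::real \<times> real. fst z - snd z \<le> b}"
    by (intro closed_Collect_le continuous_intros)+
  ultimately show ?thesis by (auto intro!: compact_Int_closed compact_Times)
qed

text \<open>
  Uniqueness for the Goursat problem in the weak sense in which the kernel is given: the
  equation is available in the open set only. The maximum M of |E| exp (- lam (|u| + |v|)) over
  the closed domain satisfies M \<le> M / 2, first with the left-hand side taken over interior
  points and then, moving along the ray through the maximal point, everywhere.
\<close>
lemma goursat_zero_data:
  fixes E Ev :: "real \<times> real \<Rightarrow> complex"
  assumes b: "b > 0" and Q: "\<And>x. x \<in> {-b..b} \<Longrightarrow> norm (q x) \<le> Q"
    and cont: "continuous_on (goursat_domain b) E"
    and dv: "\<And>u v. (u, v) \<in> open_diamond b \<Longrightarrow> ((\<lambda>w. E (u, w)) has_vector_derivative Ev (u, v)) (at v)"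
    and du: "\<And>u v. (u, v) \<in> open_diamond b \<Longrightarrow> ((\<lambda>w. Ev (w, v)) has_vector_derivative q (u + v) * E (u, v)) (at u)"
    and E1: "\<And>u. u \<in> {-b..b} \<Longrightarrow> E (u, 0) = 0"
    and E2: "\<And>v. v \<in> {-b..b} \<Longrightarrow> E (0, v) = 0"
    and z: "z \<in> goursat_domain b"
  shows "E z = 0"
proof -
  have Q0: "Q \<ge> 0" using Q[of 0] b norm_ge_zero[of "q 0"] by (simp del: norm_ge_zero)
  define lam where "lam = 2 * Q + 1"
  have lam: "lam \<ge> 1" using Q0 by (simp add: lam_def)
  have "Q / lam / lam \<le> Q / lam" using lam Q0 mult_left_mono[of 1 lam Q] by (simp add: divide_simps)
  also have "\<dots> \<le> 1 / 2" using Q0 by (simp add: lam_def divide_simps)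
  finally have Qlam: "Q / lam / lam \<le> 1 / 2" .
  \<comment> \<open>The weight in both variables: one factor 1 / lam is gained by each of the two integrations.\<close>
  define w where "w z = exp (- (lam * (\<bar>fst z\<bar> + \<bar>snd z\<bar>)))" for z :: "real \<times> real"
  have contw: "continuous_on S w" for S unfolding w_def by (intro continuous_intros)
  have "\<exists>z0\<in>goursat_domain b. \<forall>z\<in>goursat_domain b. norm (E z) * w z \<le> norm (E z0) * w z0"
    using z by (intro continuous_attains_sup compact_goursat_domain continuous_intros cont contw) auto
  then obtain z0 where z0: "z0 \<in> goursat_domain b"
    and max: "\<And>z. z \<in> goursat_domain b \<Longrightarrow> norm (E z) * w z \<le> norm (E z0) * w z0" by blast
  define M where "M = norm (E z0) * w z0"
  have M0: "M \<ge> 0" by (simp add: M_def w_def)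
  have sub: "(u, v) \<in> goursat_domain b" if "(u, v) \<in> open_diamond b" for u v
    using that by (auto simp: open_diamond_def goursat_domain_def)
  have bndE: "norm (E (u, v)) \<le> M * exp (lam * (\<bar>u\<bar> + \<bar>v\<bar>))" if "(u, v) \<in> open_diamond b" for u v
  proof -
    have "norm (E (u, v)) * w (u, v) \<le> M" unfolding M_def by (rule max[OF sub[OF that]])
    then show ?thesis by (simp add: w_def exp_minus divide_simps)
  qed
  have segu: "(\<alpha>, v) \<in> open_diamond b" if "(u, v) \<in> open_diamond b" "\<alpha> \<in> closed_segment 0 u" for u v \<alpha>
    using that by (auto simp: open_diamond_def closed_segment_eq_real_ivl abs_if split: if_splits)
  have segv: "(u, \<beta>) \<in> open_diamond b" if "(u, v) \<in> open_diamond b" "\<beta> \<in> closed_segment 0 v" for u v \<beta>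
    using that by (auto simp: open_diamond_def closed_segment_eq_real_ivl abs_if split: if_splits)
  have Ev0: "Ev (0, v) = 0" if "(0, v) \<in> open_diamond b" for v
  proof -
    have "((\<lambda>w. 0) has_vector_derivative Ev (0, v)) (at v)"
      by (rule has_vector_derivative_transform_within_open[OF dv[OF that], of "{-b<..<b}"])
        (use that E2 in \<open>auto simp: open_diamond_def\<close>)
    then show ?thesis using vector_derivative_unique_at has_vector_derivative_const by blast
  qed
  have inner: "norm (Ev (u, \<beta>)) \<le> Q * M * exp (lam * \<bar>\<beta>\<bar>) / lam * exp (lam * \<bar>u\<bar>)"
    if u\<beta>: "(u, \<beta>) \<in> open_diamond b" for u \<beta>
  proof -
    have "norm (Ev (u, \<beta>) - Ev (0, \<beta>)) \<le> Q * M * exp (lam * \<bar>\<beta>\<bar>) / lam * exp (lam * \<bar>u - 0\<bar>)"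
    proof (rule weighted_increment_bound[where y = "\<lambda>\<alpha>. Ev (\<alpha>, \<beta>)" and y' = "\<lambda>\<alpha>. q (\<alpha> + \<beta>) * E (\<alpha>, \<beta>)"])
      fix \<alpha> assume \<alpha>: "\<alpha> \<in> closed_segment 0 u"
      have \<alpha>\<beta>: "(\<alpha>, \<beta>) \<in> open_diamond b" by (rule segu[OF u\<beta> \<alpha>])
      show "((\<lambda>\<alpha>. Ev (\<alpha>, \<beta>)) has_vector_derivative q (\<alpha> + \<beta>) * E (\<alpha>, \<beta>)) (at \<alpha> within closed_segment 0 u)"
        by (rule has_vector_derivative_at_within[OF du[OF \<alpha>\<beta>]])
      have "norm (q (\<alpha> + \<beta>) * E (\<alpha>, \<beta>)) \<le> Q * (M * exp (lam * (\<bar>\<alpha>\<bar> + \<bar>\<beta>\<bar>)))"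
        unfolding norm_mult using \<alpha>\<beta> Q0 by (intro mult_mono Q bndE) (auto simp: open_diamond_def)
      then show "norm (q (\<alpha> + \<beta>) * E (\<alpha>, \<beta>)) \<le> Q * M * exp (lam * \<bar>\<beta>\<bar>) * exp (lam * \<bar>\<alpha> - 0\<bar>)"
        by (simp add: distrib_left exp_add mult_ac)
    qed (use lam Q0 M0 in auto)
    then show ?thesis using Ev0[OF segu[OF u\<beta>]] by simp
  qed
  have main: "norm (E (u, v)) * w (u, v) \<le> M / 2" if uv: "(u, v) \<in> open_diamond b" for u v
  proof -
    have "norm (E (u, v) - E (u, 0)) \<le> Q * M * exp (lam * \<bar>u\<bar>) / lam / lam * exp (lam * \<bar>v - 0\<bar>)"
    proof (rule weighted_increment_bound[where y = "\<lambda>\<beta>. E (u, \<beta>)" and y' = "\<lambda>\<beta>. Ev (u, \<beta>)"])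
      fix \<beta> assume \<beta>: "\<beta> \<in> closed_segment 0 v"
      show "((\<lambda>\<beta>. E (u, \<beta>)) has_vector_derivative Ev (u, \<beta>)) (at \<beta> within closed_segment 0 v)"
        by (rule has_vector_derivative_at_within[OF dv[OF segv[OF uv \<beta>]]])
      show "norm (Ev (u, \<beta>)) \<le> Q * M * exp (lam * \<bar>u\<bar>) / lam * exp (lam * \<bar>\<beta> - 0\<bar>)"
        using inner[OF segv[OF uv \<beta>]] by (simp add: mult_ac)
    qed (use lam Q0 M0 in auto)
    moreover have "E (u, 0) = 0" using uv by (intro E1) (auto simp: open_diamond_def)
    ultimately have "norm (E (u, v)) \<le> (Q / lam / lam * M) * exp (lam * (\<bar>u\<bar> + \<bar>v\<bar>))"
      by (simp add: distrib_left exp_add mult_ac)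
    also have "\<dots> \<le> (1 / 2 * M) * exp (lam * (\<bar>u\<bar> + \<bar>v\<bar>))"
      using Qlam M0 by (intro mult_right_mono) auto
    finally show ?thesis by (simp add: w_def exp_minus divide_simps)
  qed
  have "norm (complex_of_real (w (1 *\<^sub>R z0)) * E (1 *\<^sub>R z0)) \<le> M / 2"
  proof (rule continuous_on_closure_norm_le[where s = "{0..<1::real}"])
    have ray: "r *\<^sub>R z0 \<in> goursat_domain b" if "r \<in> {0..1}" for r
    proof -
      have "\<bar>r * (fst z0 + snd z0)\<bar> \<le> 1 * b" "\<bar>r * (fst z0 - snd z0)\<bar> \<le> 1 * b"
        unfolding abs_mult using that z0 by (intro mult_mono; auto simp: goursat_domain_def)+
      then show ?thesis by (auto simp: goursat_domain_def algebra_simps case_prod_unfold)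
    qed
    show "continuous_on (closure {0..<1::real}) (\<lambda>r. complex_of_real (w (r *\<^sub>R z0)) * E (r *\<^sub>R z0))"
      using ray
      by (auto intro!: continuous_intros continuous_on_compose2[OF contw[of UNIV]] continuous_on_compose2[OF cont])
    show "\<forall>r\<in>{0..<1}. norm (complex_of_real (w (r *\<^sub>R z0)) * E (r *\<^sub>R z0)) \<le> M / 2"
    proof
      fix r :: real assume r: "r \<in> {0..<1}"
      have "\<bar>r * s\<bar> < b" if "\<bar>s\<bar> \<le> b" for s
      proof -
        have "\<bar>r * s\<bar> \<le> r * b" unfolding abs_mult using r that by (intro mult_mono) auto
        also have "\<dots> < 1 * b" using r b by (intro mult_strict_right_mono) auto
        finally show ?thesis by simp
      qed
      from this[of "fst z0 + snd z0"] this[of "fst z0 - snd z0"] z0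
      have "(r * fst z0, r * snd z0) \<in> open_diamond b"
        by (auto simp: open_diamond_def goursat_domain_def case_prod_unfold algebra_simps abs_le_iff)
      from main[OF this] have "norm (E (r *\<^sub>R z0)) * w (r *\<^sub>R z0) \<le> M / 2"
        by (cases z0) simp
      then show "norm (complex_of_real (w (r *\<^sub>R z0)) * E (r *\<^sub>R z0)) \<le> M / 2"
        by (simp add: norm_mult w_def mult.commute)
    qed
  qed simp
  then have "M \<le> M / 2" by (simp add: norm_mult M_def w_def mult.commute)
  then have "M = 0" using M0 by simp
  moreover have "norm (E z) * w z \<le> M" unfolding M_def by (rule max[OF z])
  ultimately show ?thesis by (simp add: w_def mult_le_0_iff)
qed

section \<open>Generalized wave polynomials in characteristic coordinates\<close>

lemma LBINT_eq_primitive: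
  assumes g: "continuous_on {-b..b} g" and x: "x \<in> {-b..b}"
  shows "(LBINT s=0..x. g s) = primitive g x"
proof -
  have sub: "{min 0 x..max 0 x} \<subseteq> {-b..b}" using x by auto
  have "(LBINT s=ereal 0..ereal x. g s) = primitive g x - primitive g 0"
    using sub by (intro interval_integral_FTC_finite continuous_on_subset[OF g]
        has_vector_derivative_within_subset[OF primitive_has_vector_derivative[OF g] sub]) auto
  then show ?thesis by (simp add: zero_ereal_def)
qed

text \<open>
  The factor X_k with phi_k = f X_k. Depending on the parity of k it is taken from one or the
  other of the two sequences of iterated integrals, and the other choice gives its companion
  below. In terms of these two the recursion no longer depends on parity.
\<close>
definition formal_power :: "(real \<Rightarrow> complex) \<Rightarrow> nat \<Rightarrow> real \<Rightarrow> complex" where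
  "formal_power f k = (if odd k then Xf f k else Xt f k)"

definition dual_formal_power :: "(real \<Rightarrow> complex) \<Rightarrow> nat \<Rightarrow> real \<Rightarrow> complex" where
  "dual_formal_power f k = (if odd k then Xt f k else Xf f k)"

lemma formal_power_0: "formal_power f 0 x = 1" and dual_formal_power_0: "dual_formal_power f 0 x = 1"
  by (simp_all add: formal_power_def dual_formal_power_def)

lemma formal_power_Suc: "formal_power f (Suc n) x = of_nat (Suc n) * (LBINT s=0..x. dual_formal_power f n s * inverse ((f s)\<^sup>2))"
  by (simp add: formal_power_def dual_formal_power_def)

lemma dual_formal_power_Suc: "dual_formal_power f (Suc n) x = of_nat (Suc n) * (LBINT s=0..x. formal_power f n s * (f s)\<^sup>2)"
  by (simp add: formal_power_def dual_formal_power_def)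

lemma formal_power_at_0: "formal_power f k 0 = (if k = 0 then 1 else 0)" and dual_formal_power_at_0: "dual_formal_power f k 0 = (if k = 0 then 1 else 0)"
  by (cases k; simp add: formal_power_0 dual_formal_power_0 formal_power_Suc dual_formal_power_Suc flip: zero_ereal_def)+

lemma phi_eq: "phi f k x = f x * formal_power f k x"
  by (simp add: phi_def formal_power_def)

text \<open>
  The product rule for phi_k = f X_k, where the derivative of X_k is k Z_(k-1) / f^2, with Z the
  companion sequence.
\<close>
definition phi_deriv :: "(real \<Rightarrow> complex) \<Rightarrow> (real \<Rightarrow> complex) \<Rightarrow> nat \<Rightarrow> real \<Rightarrow> complex" where
  "phi_deriv f f' k x = f' x * formal_power f k x + of_nat k * (dual_formal_power f (k - 1) x * inverse (f x))"

text \<open>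
  The combinations u_(2m-1) + u_(2m) (for \<sigma> = 1) and u_(2m-1) - u_(2m) (for \<sigma> =
  -1) when m \<ge> 1, in the coordinates x = u + v and t = u - v. For q = 0 and f = 1 they are
  the monomials (2 u)^m and (2 v)^m, and in general their Cauchy data on u + v = 0 are
  monomials.
\<close>
definition signed_wave :: "(real \<Rightarrow> complex) \<Rightarrow> complex \<Rightarrow> nat \<Rightarrow> real \<times> real \<Rightarrow> complex" where
  "signed_wave f \<sigma> m = (\<lambda>(u, v). \<Sum>k\<le>m. of_nat (m choose k) * \<sigma> ^ k * (phi f (m - k) (u + v) * of_real (u - v) ^ k))"

text \<open>
  The partial derivative in v, that is, the derivative in x minus the derivative in t.
\<close>
definition signed_wave_dv :: "(real \<Rightarrow> complex) \<Rightarrow> (real \<Rightarrow> complex) \<Rightarrow> complex \<Rightarrow> nat \<Rightarrow> real \<times> real \<Rightarrow> complex" where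
  "signed_wave_dv f f' \<sigma> m = (\<lambda>(u, v). \<Sum>k\<le>m. of_nat (m choose k) * \<sigma> ^ k *
     (phi_deriv f f' (m - k) (u + v) * of_real (u - v) ^ k
      - of_nat k * (phi f (m - k) (u + v) * of_real (u - v) ^ (k - 1))))"

lemma slice_shift_derivative:
  assumes g: "\<And>x. x \<in> {-b..b} \<Longrightarrow> (g has_vector_derivative g' x) (at x within {-b..b})"
    and T: "w \<in> T" "\<And>w. w \<in> T \<Longrightarrow> c + w \<in> {-b..b}"
  shows "((\<lambda>w. g (c + w)) has_vector_derivative g' (c + w)) (at w within T)"
proof -
  have "((\<lambda>w. c + w) has_vector_derivative 1) (at w within T)"
    by (auto intro!: derivative_eq_intros)
  moreover have "(g has_vector_derivative g' (c + w)) (at (c + w) within (\<lambda>w. c + w) ` T)"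
    by (rule has_vector_derivative_within_subset[OF g]) (use T in auto)
  ultimately have "((g \<circ> (\<lambda>w. c + w)) has_vector_derivative 1 *\<^sub>R g' (c + w)) (at w within T)"
    by (rule vector_diff_chain_within)
  then show ?thesis by (simp add: o_def)
qed

lemma power_shift_derivative:
  "((\<lambda>w. complex_of_real (c + d * w) ^ k) has_vector_derivative of_real d * (of_nat k * of_real (c + d * w) ^ (k - 1))) (at w within T)"
proof -
  have "((\<lambda>w. of_real (c + d * w)) has_vector_derivative complex_of_real d) (at w within T)"
    unfolding has_vector_derivative_def by (auto intro!: derivative_eq_intros simp: scaleR_conv_of_real mult.commute)
  moreover have "((\<lambda>z. z ^ k) has_field_derivative of_nat k * of_real (c + d * w) ^ (k - 1))
     (at (complex_of_real (c + d * w)) within (\<lambda>w. of_real (c + d * w)) ` T)"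
    by (auto intro!: derivative_eq_intros)
  ultimately show ?thesis
    using field_vector_diff_chain_within[of "\<lambda>w. of_real (c + d * w)" "complex_of_real d" w T "\<lambda>z. z ^ k"]
    by (simp add: o_def)
qed

lemma binomial_shift2:
  assumes "k \<le> n"
  shows "(Suc (Suc n) choose k) * ((Suc (Suc n) - k) * (Suc (Suc n) - k - 1))
    = (Suc (Suc n) choose Suc (Suc k)) * (Suc (Suc k) * Suc k)"
proof -
  let ?N = "Suc (Suc n)"
  have s: "Suc j * (?N choose Suc j) = (?N - j) * (?N choose j)" for j
    by (metis binomial_absorb_comp binomial_absorption)
  have "(?N choose Suc (Suc k)) * (Suc (Suc k) * Suc k) = Suc k * ((?N - Suc k) * (?N choose Suc k))"
    using s[of "Suc k"] by (simp only: mult_ac)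
  also have "\<dots> = (?N - Suc k) * (Suc k * (?N choose Suc k))" by (simp only: mult_ac)
  also have "\<dots> = (?N - Suc k) * ((?N - k) * (?N choose k))" by (simp only: s)
  finally show ?thesis by (simp add: mult_ac del: binomial_Suc_Suc)
qed

text \<open>
  The identity behind the wave equation: the contribution (m-k)(m-k-1) phi_(m-k-2) t^k of the
  second derivative in x reappears, two indices later, as the second derivative in t.
\<close>
lemma wave_sum_shift:
  fixes \<sigma> t :: complex
  assumes \<sigma>: "\<sigma> * \<sigma> = 1"
  shows "(\<Sum>k\<le>m. of_nat (m choose k) * \<sigma> ^ k * (of_nat ((m - k) * (m - k - 1)) * F (m - k - 2) * t ^ k))
    = (\<Sum>k\<le>m. of_nat (m choose k) * \<sigma> ^ k * (of_nat (k * (k - 1)) * F (m - k) * t ^ (k - 2)))"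
    (is "?L m = ?R m")
proof (cases "m < 2")
  case True
  then have "m = 0 \<or> m = 1" by auto
  then show ?thesis by auto
next
  case False
  then obtain n where m: "m = Suc (Suc n)" using that[of "m - 2"] by simp
  have R: "?R m = (\<Sum>k\<le>n. of_nat (m choose Suc (Suc k)) * \<sigma> ^ Suc (Suc k) * (of_nat (Suc (Suc k) * Suc k) * F (n - k) * t ^ k))"
  proof -
    let ?r = "\<lambda>k. of_nat (m choose k) * \<sigma> ^ k * (of_nat (k * (k - 1)) * F (m - k) * t ^ (k - 2))"
    have "?R m = (\<Sum>k\<le>Suc (Suc n). ?r k)" by (simp only: m)
    also have "\<dots> = ?r 0 + (?r (Suc 0) + (\<Sum>k\<le>n. ?r (Suc (Suc k))))"
      by (simp only: sum.atMost_Suc_shift)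
    also have "\<dots> = (\<Sum>k\<le>n. ?r (Suc (Suc k)))" by simp
    finally show ?thesis by (simp only: m diff_Suc_Suc diff_Suc_1 numeral_2_eq_2 diff_zero)
  qed
  note R
  also have "(\<Sum>k\<le>n. of_nat (m choose Suc (Suc k)) * \<sigma> ^ Suc (Suc k) * (of_nat (Suc (Suc k) * Suc k) * F (n - k) * t ^ k))
    = (\<Sum>k\<le>n. of_nat (m choose k) * \<sigma> ^ k * (of_nat ((m - k) * (m - k - 1)) * F (m - k - 2) * t ^ k))"
  proof (rule sum.cong)
    fix k assume k: "k \<in> {..n}"
    have 1: "\<sigma> ^ Suc (Suc k) = \<sigma> ^ k" using \<sigma> by (simp add: mult.assoc[symmetric])
    have 2: "of_nat ((m choose Suc (Suc k)) * (Suc (Suc k) * Suc k)) = (of_nat ((m choose k) * ((m - k) * (m - k - 1))) :: complex)"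
      using binomial_shift2[of k n] k unfolding m by simp
    have 3: "m - k - 2 = n - k" using k by (simp add: m)
    have "of_nat (m choose Suc (Suc k)) * \<sigma> ^ Suc (Suc k) * (of_nat (Suc (Suc k) * Suc k) * F (n - k) * t ^ k)
       = of_nat ((m choose Suc (Suc k)) * (Suc (Suc k) * Suc k)) * (\<sigma> ^ Suc (Suc k) * (F (n - k) * t ^ k))"
      by (simp only: of_nat_mult mult_ac)
    also have "\<dots> = of_nat ((m choose k) * ((m - k) * (m - k - 1))) * (\<sigma> ^ k * (F (m - k - 2) * t ^ k))"
      by (simp only: 1 2 3)
    also have "\<dots> = of_nat (m choose k) * \<sigma> ^ k * (of_nat ((m - k) * (m - k - 1)) * F (m - k - 2) * t ^ k)"
      by (simp only: of_nat_mult mult_ac)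
    finally show "of_nat (m choose Suc (Suc k)) * \<sigma> ^ Suc (Suc k) * (of_nat (Suc (Suc k) * Suc k) * F (n - k) * t ^ k)
       = of_nat (m choose k) * \<sigma> ^ k * (of_nat ((m - k) * (m - k - 1)) * F (m - k - 2) * t ^ k)" .
  qed simp
  also have "\<dots> = ?L m"
  proof -
    let ?l = "\<lambda>k. of_nat (m choose k) * \<sigma> ^ k * (of_nat ((m - k) * (m - k - 1)) * F (m - k - 2) * t ^ k)"
    have "?L m = (\<Sum>k\<le>Suc (Suc n). ?l k)" by (simp only: m)
    also have "\<dots> = (\<Sum>k\<le>n. ?l k) + ?l (Suc n) + ?l (Suc (Suc n))" by (simp only: sum.atMost_Suc)
    also have "?l (Suc n) = 0" by (simp add: m)
    also have "?l (Suc (Suc n)) = 0" by (simp add: m)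
    finally show ?thesis by simp
  qed
  finally show ?thesis by simp
qed

locale particular_solution =
  fixes b :: real and f f' q :: "real \<Rightarrow> complex"
  assumes df: "\<And>x. x \<in> {-b..b} \<Longrightarrow> (f has_vector_derivative f' x) (at x within {-b..b})"
    and ddf: "\<And>x. x \<in> {-b..b} \<Longrightarrow> (f' has_vector_derivative q x * f x) (at x within {-b..b})"
    and f_nz: "\<And>x. x \<in> {-b..b} \<Longrightarrow> f x \<noteq> 0"
    and f0: "f 0 = 1"
begin

lemma continuous_on_f: "continuous_on {-b..b} f"
  using has_vector_derivative_continuous[OF df] by (simp add: continuous_on_eq_continuous_within)

lemma continuous_formal_powers: "continuous_on {-b..b} (formal_power f k) \<and> continuous_on {-b..b} (dual_formal_power f k)"
proof (induction k)
  case 0 then show ?case by (simp add: formal_power_0 dual_formal_power_0 cong: continuous_on_cong)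
next
  case (Suc k)
  have c: "continuous_on {-b..b} (\<lambda>s. dual_formal_power f k s * inverse ((f s)\<^sup>2))" "continuous_on {-b..b} (\<lambda>s. formal_power f k s * (f s)\<^sup>2)"
    using Suc f_nz by (auto intro!: continuous_intros continuous_on_f)
  have p: "continuous_on {-b..b} (primitive g)" if "continuous_on {-b..b} g" for g
    using has_vector_derivative_continuous[OF primitive_has_vector_derivative[OF that]]
    by (simp add: continuous_on_eq_continuous_within)
  have 1: "continuous_on {-b..b} (\<lambda>x. of_nat (Suc k) * primitive (\<lambda>s. dual_formal_power f k s * inverse ((f s)\<^sup>2)) x)"
    and 2: "continuous_on {-b..b} (\<lambda>x. of_nat (Suc k) * primitive (\<lambda>s. formal_power f k s * (f s)\<^sup>2) x)"
    by (intro continuous_intros p c)+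
  show ?case
  proof
    show "continuous_on {-b..b} (formal_power f (Suc k))"
      by (rule continuous_on_eq[OF 1]) (simp add: formal_power_Suc LBINT_eq_primitive[OF c(1)] del: of_nat_Suc)
    show "continuous_on {-b..b} (dual_formal_power f (Suc k))"
      by (rule continuous_on_eq[OF 2]) (simp add: dual_formal_power_Suc LBINT_eq_primitive[OF c(2)] del: of_nat_Suc)
  qed
qed

lemma formal_power_derivative:
  assumes x: "x \<in> {-b..b}"
  shows "(formal_power f k has_vector_derivative of_nat k * (dual_formal_power f (k - 1) x * inverse ((f x)\<^sup>2))) (at x within {-b..b})"
proof (cases k)
  case 0
  have "((\<lambda>x. 1 :: complex) has_vector_derivative 0) (at x within {-b..b})" by simp
  then show ?thesis using 0 by (simp add: formal_power_0[abs_def])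
next
  case (Suc n)
  have c: "continuous_on {-b..b} (\<lambda>s. dual_formal_power f n s * inverse ((f s)\<^sup>2))"
    using continuous_formal_powers f_nz by (auto intro!: continuous_intros continuous_on_f)
  show ?thesis unfolding Suc
    by (rule has_vector_derivative_transform[OF x])
      (use x in \<open>auto intro!: has_vector_derivative_mult_right primitive_has_vector_derivative[OF c] simp: formal_power_Suc LBINT_eq_primitive[OF c] simp del: of_nat_Suc\<close>)
qed

lemma dual_formal_power_derivative:
  assumes x: "x \<in> {-b..b}"
  shows "(dual_formal_power f k has_vector_derivative of_nat k * (formal_power f (k - 1) x * (f x)\<^sup>2)) (at x within {-b..b})"
proof (cases k)
  case 0
  have "((\<lambda>x. 1 :: complex) has_vector_derivative 0) (at x within {-b..b})" by simp
  then show ?thesis using 0 by (simp add: dual_formal_power_0[abs_def])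
next
  case (Suc n)
  have c: "continuous_on {-b..b} (\<lambda>s. formal_power f n s * (f s)\<^sup>2)"
    using continuous_formal_powers by (auto intro!: continuous_intros continuous_on_f)
  show ?thesis unfolding Suc
    by (rule has_vector_derivative_transform[OF x])
      (use x in \<open>auto intro!: has_vector_derivative_mult_right primitive_has_vector_derivative[OF c] simp: dual_formal_power_Suc LBINT_eq_primitive[OF c] simp del: of_nat_Suc\<close>)
qed

lemma phi_derivative:
  assumes x: "x \<in> {-b..b}"
  shows "(phi f k has_vector_derivative phi_deriv f f' k x) (at x within {-b..b})"
proof -
  have "((\<lambda>x. f x * formal_power f k x) has_vector_derivative
      f x * (of_nat k * (dual_formal_power f (k - 1) x * inverse ((f x)\<^sup>2))) + f' x * formal_power f k x) (at x within {-b..b})"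
    by (intro has_vector_derivative_mult df formal_power_derivative x)
  also have "f x * (of_nat k * (dual_formal_power f (k - 1) x * inverse ((f x)\<^sup>2))) + f' x * formal_power f k x = phi_deriv f f' k x"
    using f_nz[OF x] by (simp add: phi_deriv_def field_simps power2_eq_square)
  finally show ?thesis by (simp add: phi_eq[abs_def])
qed

text \<open>
  The basic property of the functions phi_k: the operator d^2/dx^2 - q lowers the index by two,
  as the second derivative does for the powers of x.
\<close>
lemma phi_deriv_derivative:
  assumes x: "x \<in> {-b..b}"
  shows "(phi_deriv f f' k has_vector_derivative q x * phi f k x + of_nat (k * (k - 1)) * phi f (k - 2) x) (at x within {-b..b})"
proof -
  have "((\<lambda>x. inverse (f x)) has_derivative (\<lambda>h. - (inverse (f x) * (h *\<^sub>R f' x) * inverse (f x)))) (at x within {-b..b})"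
    using Deriv.has_derivative_inverse[OF f_nz[OF x] df[OF x, unfolded has_vector_derivative_def]] .
  then have di: "((\<lambda>x. inverse (f x)) has_vector_derivative - (f' x * inverse ((f x)\<^sup>2))) (at x within {-b..b})"
    by (simp add: has_vector_derivative_def power2_eq_square mult_ac)
  have "((\<lambda>x. f' x * formal_power f k x + of_nat k * (dual_formal_power f (k - 1) x * inverse (f x))) has_vector_derivative
      (f' x * (of_nat k * (dual_formal_power f (k - 1) x * inverse ((f x)\<^sup>2))) + q x * f x * formal_power f k x)
      + of_nat k * (dual_formal_power f (k - 1) x * - (f' x * inverse ((f x)\<^sup>2))
          + of_nat (k - 1) * (formal_power f (k - 1 - 1) x * (f x)\<^sup>2) * inverse (f x))) (at x within {-b..b})"
    by (intro has_vector_derivative_add has_vector_derivative_mult has_vector_derivative_mult_right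
        ddf formal_power_derivative dual_formal_power_derivative di x)
  also have "(f' x * (of_nat k * (dual_formal_power f (k - 1) x * inverse ((f x)\<^sup>2))) + q x * f x * formal_power f k x)
      + of_nat k * (dual_formal_power f (k - 1) x * - (f' x * inverse ((f x)\<^sup>2))
          + of_nat (k - 1) * (formal_power f (k - 1 - 1) x * (f x)\<^sup>2) * inverse (f x))
      = q x * phi f k x + of_nat (k * (k - 1)) * phi f (k - 2) x"
    using f_nz[OF x] by (simp add: phi_eq field_simps power2_eq_square numeral_2_eq_2)
  finally show ?thesis by (simp add: phi_deriv_def[abs_def])
qed

lemma continuous_phi: "continuous_on {-b..b} (phi f k)"
  using has_vector_derivative_continuous[OF phi_derivative] by (simp add: continuous_on_eq_continuous_within)

lemma phi_at_0: "phi f k 0 = (if k = 0 then 1 else 0)"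
  by (simp add: phi_eq formal_power_at_0 f0)

lemma phi_deriv_at_0:
  "phi_deriv f f' k 0 = (if k = 0 then f' 0 else if k = 1 then 1 else 0)"
  by (auto simp: phi_deriv_def formal_power_at_0 dual_formal_power_at_0 f0)

lemma signed_wave_derivative_v:
  assumes uv: "(u, v) \<in> hexagon b"
  shows "((\<lambda>w. signed_wave f \<sigma> m (u, w)) has_vector_derivative signed_wave_dv f f' \<sigma> m (u, v)) (at v within {w. (u, w) \<in> hexagon b})"
proof -
  let ?T = "{w. (u, w) \<in> hexagon b}"
  have T: "v \<in> ?T" "\<And>w. w \<in> ?T \<Longrightarrow> u + w \<in> {-b..b}" using uv by (auto simp: hexagon_def)
  have P: "((\<lambda>w. complex_of_real (u - w) ^ k) has_vector_derivative - (of_nat k * of_real (u - v) ^ (k - 1))) (at v within ?T)" for k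
    using power_shift_derivative[of u "-1" k v ?T] by simp
  have F: "((\<lambda>w. phi f j (u + w)) has_vector_derivative phi_deriv f f' j (u + v)) (at v within ?T)" for j
    by (rule slice_shift_derivative[OF phi_derivative T])
  have "((\<lambda>w. \<Sum>k\<le>m. of_nat (m choose k) * \<sigma> ^ k * (phi f (m - k) (u + w) * of_real (u - w) ^ k)) has_vector_derivative
      (\<Sum>k\<le>m. of_nat (m choose k) * \<sigma> ^ k * (phi f (m - k) (u + v) * - (of_nat k * of_real (u - v) ^ (k - 1)) + phi_deriv f f' (m - k) (u + v) * of_real (u - v) ^ k)))
      (at v within ?T)"
    by (intro has_vector_derivative_sum has_vector_derivative_mult_right has_vector_derivative_mult P F)
  then show ?thesis by (simp add: signed_wave_def signed_wave_dv_def algebra_simps)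
qed

lemma signed_wave_dv_derivative_u:
  assumes uv: "(u, v) \<in> hexagon b" and \<sigma>: "\<sigma> * \<sigma> = 1"
  shows "((\<lambda>w. signed_wave_dv f f' \<sigma> m (w, v)) has_vector_derivative q (u + v) * signed_wave f \<sigma> m (u, v)) (at u within {w. (w, v) \<in> hexagon b})"
proof -
  let ?T = "{w. (w, v) \<in> hexagon b}"
  let ?x = "u + v" and ?t = "complex_of_real (u - v)"
  let ?ddphi = "\<lambda>k. q ?x * phi f k ?x + of_nat (k * (k - 1)) * phi f (k - 2) ?x"
  have T: "u \<in> ?T" "\<And>w. w \<in> ?T \<Longrightarrow> v + w \<in> {-b..b}" using uv by (auto simp: hexagon_def)
  have P: "((\<lambda>w. complex_of_real (w - v) ^ k) has_vector_derivative (of_nat k * ?t ^ (k - 1))) (at u within ?T)" for k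
    using power_shift_derivative[of "-v" 1 k u ?T] by simp
  have F: "((\<lambda>w. phi f j (w + v)) has_vector_derivative phi_deriv f f' j ?x) (at u within ?T)" for j
    using slice_shift_derivative[OF phi_derivative T] by (simp add: add.commute)
  have F1: "((\<lambda>w. phi_deriv f f' j (w + v)) has_vector_derivative ?ddphi j) (at u within ?T)" for j
    using slice_shift_derivative[OF phi_deriv_derivative T] by (simp add: add.commute)
  have "((\<lambda>w. \<Sum>k\<le>m. of_nat (m choose k) * \<sigma> ^ k *
     (phi_deriv f f' (m - k) (w + v) * of_real (w - v) ^ k
      - of_nat k * (phi f (m - k) (w + v) * of_real (w - v) ^ (k - 1)))) has_vector_derivative
    (\<Sum>k\<le>m. of_nat (m choose k) * \<sigma> ^ k *
     ((phi_deriv f f' (m - k) ?x * (of_nat k * ?t ^ (k - 1)) + ?ddphi (m - k) * ?t ^ k)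
      - of_nat k * (phi f (m - k) ?x * (of_nat (k - 1) * ?t ^ (k - 1 - 1)) + phi_deriv f f' (m - k) ?x * ?t ^ (k - 1)))))
      (at u within ?T)"
    by (intro has_vector_derivative_sum has_vector_derivative_mult_right has_vector_derivative_mult
        has_vector_derivative_diff P F F1)
  also have "(\<Sum>k\<le>m. of_nat (m choose k) * \<sigma> ^ k *
     ((phi_deriv f f' (m - k) ?x * (of_nat k * ?t ^ (k - 1)) + ?ddphi (m - k) * ?t ^ k)
      - of_nat k * (phi f (m - k) ?x * (of_nat (k - 1) * ?t ^ (k - 1 - 1)) + phi_deriv f f' (m - k) ?x * ?t ^ (k - 1))))
    = (\<Sum>k\<le>m. q ?x * (of_nat (m choose k) * \<sigma> ^ k * (phi f (m - k) ?x * ?t ^ k))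
       + of_nat (m choose k) * \<sigma> ^ k * (of_nat ((m - k) * (m - k - 1)) * phi f (m - k - 2) ?x * ?t ^ k)
       - of_nat (m choose k) * \<sigma> ^ k * (of_nat (k * (k - 1)) * phi f (m - k) ?x * ?t ^ (k - 2)))"
    unfolding of_nat_mult by (intro sum.cong refl) (simp add: algebra_simps numeral_2_eq_2)
  also have "\<dots> = q ?x * signed_wave f \<sigma> m (u, v)"
    unfolding sum.distrib sum_subtractf wave_sum_shift[OF \<sigma>, of m "\<lambda>j. phi f j ?x" ?t]
    by (simp add: signed_wave_def sum_distrib_left)
  finally show ?thesis by (simp add: signed_wave_dv_def)
qed

lemma continuous_signed_wave: "continuous_on (hexagon b) (signed_wave f \<sigma> m)"
proof -
  have "continuous_on (hexagon b) (\<lambda>z. \<Sum>k\<le>m. of_nat (m choose k) * \<sigma> ^ k * (phi f (m - k) (fst z + snd z) * of_real (fst z - snd z) ^ k))"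
    by (intro continuous_intros continuous_on_compose2[OF continuous_phi]) (auto simp: hexagon_def)
  then show ?thesis by (simp add: signed_wave_def case_prod_unfold)
qed

lemma signed_wave_at_0:
  shows "signed_wave f \<sigma> m (u, -u) = \<sigma> ^ m * of_real (2 * u) ^ m"
proof -
  have "signed_wave f \<sigma> m (u, -u) = (\<Sum>k\<le>m. if k = m then \<sigma> ^ m * of_real (2 * u) ^ m else 0)"
    unfolding signed_wave_def prod.case by (intro sum.cong) (auto simp: phi_at_0)
  then show ?thesis by simp
qed

text \<open>
  The second Cauchy datum is a pure monomial: it vanishes for \<sigma> = 1, and for \<sigma> =
  -1 it is the derivative of (2 s)^m. The h in the combination removes the term coming from
  phi_0' (0) = h.
\<close>
lemma signed_wave_dv_at_0:
  shows "signed_wave_dv f f' \<sigma> m (-s, s) - f' 0 * signed_wave f \<sigma> m (-s, s)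
    = of_nat m * (\<sigma> ^ (m - 1) - \<sigma> ^ m) * of_real (- 2 * s) ^ (m - 1)"
proof -
  let ?t = "complex_of_real (- 2 * s)"
  have "signed_wave_dv f f' \<sigma> m (-s, s) = (\<Sum>k\<le>m. (if k = m then \<sigma> ^ m * (f' 0 * ?t ^ m - of_nat m * ?t ^ (m - 1)) else 0)
      + (if k = m - 1 then (if m = 0 then 0 else of_nat m * \<sigma> ^ (m - 1) * ?t ^ (m - 1)) else 0))"
    unfolding signed_wave_dv_def prod.case
  proof (intro sum.cong refl)
    fix k assume "k \<in> {..m}"
    then consider "k = m" | "m = Suc k" | "Suc k < m" by fastforce
    then show "of_nat (m choose k) * \<sigma> ^ k *
       (phi_deriv f f' (m - k) (- s + s) * of_real (- s - s) ^ k - of_nat k * (phi f (m - k) (- s + s) * of_real (- s - s) ^ (k - 1)))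
      = (if k = m then \<sigma> ^ m * (f' 0 * ?t ^ m - of_nat m * ?t ^ (m - 1)) else 0)
      + (if k = m - 1 then (if m = 0 then 0 else of_nat m * \<sigma> ^ (m - 1) * ?t ^ (m - 1)) else 0)"
      by cases (auto simp: phi_at_0 phi_deriv_at_0)
  qed
  also have "\<dots> = \<sigma> ^ m * (f' 0 * ?t ^ m - of_nat m * ?t ^ (m - 1))
      + (if m = 0 then 0 else of_nat m * \<sigma> ^ (m - 1) * ?t ^ (m - 1))"
    by (simp add: sum.distrib)
  finally show ?thesis using signed_wave_at_0[of \<sigma> m "-s"] by (simp add: algebra_simps)
qed

end

lemma signed_wave_wave_poly:
  shows "signed_wave f 1 0 (u, v) = wave_poly f 0 (u + v) (u - v)"
    and "signed_wave f (-1) 0 (u, v) = wave_poly f 0 (u + v) (u - v)"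
    and "m \<ge> 1 \<Longrightarrow> signed_wave f 1 m (u, v) = wave_poly f (2 * m - 1) (u + v) (u - v) + wave_poly f (2 * m) (u + v) (u - v)"
    and "m \<ge> 1 \<Longrightarrow> signed_wave f (-1) m (u, v) = wave_poly f (2 * m - 1) (u + v) (u - v) - wave_poly f (2 * m) (u + v) (u - v)"
proof -
  show "signed_wave f 1 0 (u, v) = wave_poly f 0 (u + v) (u - v)"
    and "signed_wave f (-1) 0 (u, v) = wave_poly f 0 (u + v) (u - v)" by (simp_all add: signed_wave_def wave_poly_def)
  let ?term = "\<lambda>k. of_nat (m choose k) * phi f (m - k) (u + v) * of_real (u - v) ^ k"
  assume m: "m \<ge> 1"
  have o: "wave_poly f (2 * m - 1) (u + v) (u - v) = (\<Sum>k\<in>{k\<in>{..m}. even k}. ?term k)"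
  proof -
    have "(2 * m - 1 + 1) div 2 = m" "odd (2 * m - 1)" "2 * m - 1 \<noteq> 0" using m by auto
    then show ?thesis unfolding wave_poly_def Let_def by simp
  qed
  have e: "wave_poly f (2 * m) (u + v) (u - v) = (\<Sum>k\<in>{k\<in>{..m}. odd k}. ?term k)"
  proof -
    have "(2 * m + 1) div 2 = m" "2 * m \<noteq> 0" using m by auto
    then show ?thesis unfolding wave_poly_def Let_def by simp
  qed
  have split: "(\<Sum>k\<le>m. g k) = (\<Sum>k\<in>{k\<in>{..m}. even k}. g k) + (\<Sum>k\<in>{k\<in>{..m}. odd k}. g k)" for g :: "nat \<Rightarrow> complex"
    by (subst sum.union_disjoint[symmetric]) (auto intro!: sum.cong)
  show "signed_wave f 1 m (u, v) = wave_poly f (2 * m - 1) (u + v) (u - v) + wave_poly f (2 * m) (u + v) (u - v)"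
    unfolding o e split[symmetric] by (simp add: signed_wave_def mult.assoc)
  have "signed_wave f (-1) m (u, v) = (\<Sum>k\<in>{k\<in>{..m}. even k}. ?term k) + (\<Sum>k\<in>{k\<in>{..m}. odd k}. - ?term k)"
    unfolding signed_wave_def prod.case split
    by (intro arg_cong2[of _ _ _ _ "(+)"] sum.cong) (auto simp: mult.assoc)
  then show "signed_wave f (-1) m (u, v) = wave_poly f (2 * m - 1) (u + v) (u - v) - wave_poly f (2 * m) (u + v) (u - v)"
    unfolding o e by (simp add: sum_negf)
qed

section \<open>Approximation of the transmutation kernel\<close>

lemma poly_sum_upto:
  fixes p :: "complex poly"
  assumes "degree p \<le> n"
  shows "poly p x = (\<Sum>i\<le>n. coeff p i * x ^ i)"
  unfolding poly_altdef using assms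
  by (intro sum.mono_neutral_left) (auto simp: coeff_eq_0)

text \<open>
  The given solution is known only on the set |u| + |v| \<le> b. There it coincides with any
  solution on the larger square that has the same data on the two axes.
\<close>
lemma goursat_solution_eq:
  assumes b: "b > 0" and q: "continuous_on {-b..b} q"
    and G: "goursat_solution b q h G"
    and cH: "continuous_on (square b) H"
    and dv: "\<And>u v. u \<in> {-b..b} \<Longrightarrow> v \<in> {-b..b} \<Longrightarrow>
      ((\<lambda>v. H (u, v)) has_vector_derivative Hv (u, v)) (at v within {-b..b})"
    and du: "\<And>u v. (u, v) \<in> goursat_domain b \<Longrightarrow>
      ((\<lambda>u. Hv (u, v)) has_vector_derivative q (u + v) * H (u, v)) (at u within {-b..b})"
    and da: "\<And>x. x \<in> {-b..b} \<Longrightarrow> (a has_vector_derivative q x / 2) (at x within {-b..b})"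
    and a0: "a 0 = h / 2"
    and Hu0: "\<And>u. u \<in> {-b..b} \<Longrightarrow> H (u, 0) = a u"
    and H0v: "\<And>v. v \<in> {-b..b} \<Longrightarrow> H (0, v) = h / 2"
    and z: "(u, v) \<in> goursat_domain b"
  shows "G u v = H (u, v)"
proof -
  obtain Gv where cG: "continuous_on (goursat_domain b) (\<lambda>(u, v). G u v)"
    and Gd: "\<And>u v. (u, v) \<in> interior (goursat_domain b) \<Longrightarrow>
        ((\<lambda>w. G u w) has_vector_derivative Gv u v) (at v) \<and>
        ((\<lambda>w. Gv w v) has_vector_derivative q (u + v) * G u v) (at u)"
    and G1: "\<And>u. u \<in> {-b..b} \<Longrightarrow> G u 0 = h / 2 + 1 / 2 * (LBINT s=0..u. q s)"
    and G2: "\<And>v. v \<in> {-b..b} \<Longrightarrow> G 0 v = h / 2"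
    using G unfolding goursat_solution_def by blast
  have "compact (q ` {-b..b})" by (intro compact_continuous_image q) auto
  from compact_imp_bounded[OF this] obtain Q where Q: "\<And>x. x \<in> {-b..b} \<Longrightarrow> norm (q x) \<le> Q"
    unfolding bounded_iff by blast
  have sub: "goursat_domain b \<subseteq> square b" by (auto simp: goursat_domain_def)
  have od: "(u, v) \<in> interior (goursat_domain b)" "(u, v) \<in> goursat_domain b" "-b < u" "u < b" "-b < v" "v < b"
    if "(u, v) \<in> open_diamond b" for u v
    using that open_diamond_subset_interior[of b] interior_subset[of "goursat_domain b"]
    by (blast, blast, simp_all add: open_diamond_def abs_if split: if_splits)
  have "(\<lambda>(u, v). G u v - H (u, v)) (u, v) = 0"
  proof (rule goursat_zero_data[OF b Q, where Ev = "\<lambda>(u, v). Gv u v - Hv (u, v)"])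
    show "continuous_on (goursat_domain b) (\<lambda>(u, v). G u v - H (u, v))"
      using continuous_on_diff[OF cG continuous_on_subset[OF cH sub]] by (simp add: case_prod_unfold)
    show "((\<lambda>w. case (u, w) of (u, v) \<Rightarrow> G u v - H (u, v)) has_vector_derivative
        (case (u, v) of (u, v) \<Rightarrow> Gv u v - Hv (u, v))) (at v)"
      if uv: "(u, v) \<in> open_diamond b" for u v
      using Gd[OF od(1)[OF uv]] dv[of u v] od[OF uv]
      by (auto intro!: has_vector_derivative_diff simp: at_within_Icc_at)
    show "((\<lambda>w. case (w, v) of (u, v) \<Rightarrow> Gv u v - Hv (u, v)) has_vector_derivative
        q (u + v) * (case (u, v) of (u, v) \<Rightarrow> G u v - H (u, v))) (at u)"
      if uv: "(u, v) \<in> open_diamond b" for u v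
      using Gd[OF od(1)[OF uv]] du[of u v] od[OF uv]
      by (auto intro!: has_vector_derivative_diff simp: at_within_Icc_at right_diff_distrib)
    show "(case (u, 0) of (u, v) \<Rightarrow> G u v - H (u, v)) = 0" if u: "u \<in> {-b..b}" for u
    proof -
      have seg: "{min 0 u..max 0 u} \<subseteq> {-b..b}" using u by auto
      have "(LBINT s=ereal 0..ereal u. q s) = 2 * a u - 2 * a 0"
      proof (rule interval_integral_FTC_finite)
        show "continuous_on {min 0 u..max 0 u} q" by (rule continuous_on_subset[OF q seg])
        fix x assume "min 0 u \<le> x" "x \<le> max 0 u"
        then have "x \<in> {-b..b}" using seg by auto
        from has_vector_derivative_mult_right[OF da[OF this], of 2]
        show "((\<lambda>x. 2 * a x) has_vector_derivative q x) (at x within {min 0 u..max 0 u})"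
          by (auto intro: has_vector_derivative_within_subset[OF _ seg])
      qed
      then show ?thesis using G1[OF u] Hu0[OF u] a0 by (simp add: zero_ereal_def diff_divide_distrib add_divide_distrib)
    qed
    show "(case (0, v) of (u, v) \<Rightarrow> G u v - H (u, v)) = 0" if "v \<in> {-b..b}" for v
      unfolding prod.case G2[OF that] H0v[OF that] by (rule diff_self)
  qed (use z in auto)
  then show ?thesis by simp
qed

theorem theorem7p1:
  fixes b :: real and p :: nat and q f f' :: "real \<Rightarrow> complex" and h :: complex
    and K :: "real \<Rightarrow> real \<Rightarrow> complex"
  assumes "b > 0"
    and "Ck_on p q {- b..b}"
    and "\<And>x. x \<in> {- b..b} \<Longrightarrow> (f has_vector_derivative f' x) (at x within {- b..b})"
    and "\<And>x. x \<in> {- b..b} \<Longrightarrow> (f' has_vector_derivative q x * f x) (at x within {- b..b})"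
    and "\<And>x. x \<in> {- b..b} \<Longrightarrow> f x \<noteq> 0"
    and "f 0 = 1"
    and "h = f' 0"
    and "transmutation_kernel b q h K"
  shows "\<exists>(c :: real) (KN :: nat \<Rightarrow> real \<Rightarrow> real \<Rightarrow> complex).
    \<forall>N\<ge>1.
      (\<exists>(\<alpha> :: nat \<Rightarrow> complex) (\<beta> :: nat \<Rightarrow> complex). \<forall>x\<in>{- b..b}. \<forall>t\<in>{- b..b}.
         KN N x t = \<alpha> 0 * wave_poly f 0 x t
           + (\<Sum>n=1..N. \<alpha> n * wave_poly f (2 * n - 1) x t)
           + (\<Sum>n=1..N. \<beta> n * wave_poly f (2 * n) x t)) \<and>
      (\<forall>x\<in>{- b..b}. \<forall>t\<in>{- b..b}. cmod (K x t - KN N x t) \<le> c / real N ^ (p + 1))"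
proof -
  note b = assms(1) and h = assms(7)
  interpret particular_solution b f f' q
    by unfold_locales (fact assms)+
  have cq: "continuous_on {-b..b} q" by (rule Ck_on_continuous_on[OF assms(2)])
  have "compact (q ` {-b..b})" by (intro compact_continuous_image cq) auto
  from compact_imp_bounded[OF this] obtain Q where Q: "\<And>x. x \<in> {-b..b} \<Longrightarrow> norm (q x) \<le> Q"
    unfolding bounded_iff by blast
  obtain G where G: "goursat_solution b q h G"
    and KG: "\<And>x t. x \<in> {-b..b} \<Longrightarrow> t \<in> {-b..b} \<Longrightarrow> K x t = G ((x + t) / 2) ((x - t) / 2)"
    using assms(8) unfolding transmutation_kernel_def by blast
  obtain qe where qe: "Ck_on p qe UNIV" "\<And>x. x \<in> {-b..b} \<Longrightarrow> qe x = q x"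
    using Ck_on_extension[OF b assms(2)] by blast
  obtain H Hv a where CH: "Ck2 (Suc p) b H" and CHv: "Ck2 p b Hv"
    and dv: "\<And>u v. u \<in> {-b..b} \<Longrightarrow> v \<in> {-b..b} \<Longrightarrow>
      ((\<lambda>v. H (u, v)) has_vector_derivative Hv (u, v)) (at v within {-b..b})"
    and du: "\<And>u v. u \<in> {-b..b} \<Longrightarrow> v \<in> {-b..b} \<Longrightarrow>
      ((\<lambda>u. Hv (u, v)) has_vector_derivative qe (u + v) * H (u, v)) (at u within {-b..b})"
    and da: "\<And>x. (a has_vector_derivative qe x / 2) (at x)" "a 0 = h / 2"
    and Hu0: "\<And>u. u \<in> {-b..b} \<Longrightarrow> H (u, 0) = a u"
    and H0v: "\<And>v. v \<in> {-b..b} \<Longrightarrow> H (0, v) = h / 2"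
    by (rule goursat_smooth_solution[OF b qe(1), where c = "h / 2"]) (rule that)
  have cH: "continuous_on (square b) H" by (rule Ck2_continuous_on[OF CH])
  have GH: "G u v = H (u, v)" if "(u, v) \<in> goursat_domain b" for u v
  proof (rule goursat_solution_eq[OF b cq G cH dv _ _ da(2) Hu0 H0v that])
    show "((\<lambda>u. Hv (u, v)) has_vector_derivative q (u + v) * H (u, v)) (at u within {-b..b})"
      if "(u, v) \<in> goursat_domain b" for u v
    proof -
      have "u \<in> {-b..b}" "v \<in> {-b..b}" "u + v \<in> {-b..b}" using that by (auto simp: goursat_domain_def)
      then show ?thesis using du[of u v] qe(2) by simp
    qed
    show "(a has_vector_derivative q x / 2) (at x within {-b..b})" if "x \<in> {-b..b}" for x
      using da(1)[of x] qe(2)[OF that] by (simp add: has_vector_derivative_at_within)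
  qed
  \<comment> \<open>The first Cauchy datum: K (0, 2 u), continued to |u| \<le> b.\<close>
  define A where "A u = H (u, -u)" for u
  have CA: "Ck_on (Suc p) A {-b..b}"
    using Ck_on_line[OF CH, of 1 "-1"] by (simp add: A_def[abs_def] del: Ck_on.simps)
  \<comment> \<open>The second Cauchy datum on x = 0. It is as smooth as H_v, one order less than H, so its
    integral has the same smoothness as A.\<close>
  define \<psi> where "\<psi> s = Hv (-s, s) - h * H (-s, s)" for s
  have "Ck2 p b (\<lambda>z. Hv z + (- h) * H z)"
    by (intro Ck2_add Ck2_mult Ck2_const CHv Ck2_Suc_imp[OF CH])
  from Ck_on_line[OF this, of "-1" 1] have C\<psi>: "Ck_on p \<psi> {-b..b}"
    by (simp add: \<psi>_def[abs_def])
  define \<Psi> where "\<Psi> = primitive \<psi>"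
  have d\<Psi>: "(\<Psi> has_vector_derivative \<psi> s) (at s within {-b..b})" if "s \<in> {-b..b}" for s
    unfolding \<Psi>_def by (rule primitive_has_vector_derivative[OF Ck_on_continuous_on[OF C\<psi>] that])
  have C\<Psi>: "Ck_on (Suc p) \<Psi> {-b..b}"
    unfolding Ck_on.simps by (intro exI[of _ \<psi>] conjI ballI d\<Psi> C\<psi>)
  obtain cA where cA: "\<And>N. N \<ge> 1 \<Longrightarrow> \<exists>P::complex poly. degree P \<le> N \<and>
    (\<forall>x\<in>{-b..b}. norm (A x - poly P (of_real x)) \<le> cA / real N ^ Suc p)"
    using Ck_on_polynomial_rate[OF b CA] by blast
  obtain cP where cP: "\<And>N. N \<ge> 1 \<Longrightarrow> \<exists>P::complex poly. degree P \<le> N \<and>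
    (\<forall>x\<in>{-b..b}. norm (\<Psi> x - poly P (of_real x)) \<le> cP / real N ^ Suc p)"
    using Ck_on_polynomial_rate[OF b C\<Psi>] by blast
  define c where "c = 2 * ((1 + norm h) * cA + 2 * cP) * exp ((2 * Q + 1) * b)"
  have main: "\<exists>(\<alpha> :: nat \<Rightarrow> complex) (\<beta> :: nat \<Rightarrow> complex). \<forall>x\<in>{- b..b}. \<forall>t\<in>{- b..b}.
      cmod (K x t - (\<alpha> 0 * wave_poly f 0 x t
           + (\<Sum>n=1..N. \<alpha> n * wave_poly f (2 * n - 1) x t)
           + (\<Sum>n=1..N. \<beta> n * wave_poly f (2 * n) x t))) \<le> c / real N ^ (p + 1)"
    if N: "N \<ge> 1" for N
  proof -
    obtain PA :: "complex poly" where PA: "degree PA \<le> N"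
      "\<And>x. x \<in> {-b..b} \<Longrightarrow> norm (A x - poly PA (of_real x)) \<le> cA / real N ^ Suc p" using cA[OF N] by blast
    obtain PP :: "complex poly" where PP: "degree PP \<le> N"
      "\<And>x. x \<in> {-b..b} \<Longrightarrow> norm (\<Psi> x - poly PP (of_real x)) \<le> cP / real N ^ Suc p" using cP[OF N] by blast
    \<comment> \<open>A wave with \<sigma> = -1 contributes to both data. Its coefficient is dictated by the second datum, and its
      trace (-1)^m (2 u)^m is compensated in the coefficient of the wave with \<sigma> = 1.\<close>
    define ca where "ca m = (coeff PA m - (-1) ^ m * coeff PP m) / 2 ^ m" for m
    define cb where "cb m = coeff PP m / 2 ^ m" for m
    define F where "F z = (\<Sum>m\<le>N. ca m * signed_wave f 1 m z + cb m * signed_wave f (-1) m z)" for z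
    define Fv where "Fv z = (\<Sum>m\<le>N. ca m * signed_wave_dv f f' 1 m z + cb m * signed_wave_dv f f' (-1) m z)" for z
    have F0: "F (u, -u) = poly PA (of_real u)" for u
    proof -
      have "ca m * signed_wave f 1 m (u, -u) + cb m * signed_wave f (-1) m (u, -u) = coeff PA m * of_real u ^ m" for m
        unfolding signed_wave_at_0 by (simp add: ca_def cb_def power_mult_distrib field_simps)
      then show ?thesis unfolding F_def poly_sum_upto[OF PA(1)] by simp
    qed
    have Fv0: "Fv (-s, s) - h * F (-s, s) = (\<Sum>m\<le>N. coeff PP m * (of_nat m * of_real s ^ (m - 1)))" for s
    proof -
      have "h * F (-s, s) = (\<Sum>m\<le>N. ca m * (f' 0 * signed_wave f 1 m (-s, s)) + cb m * (f' 0 * signed_wave f (-1) m (-s, s)))"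
        unfolding F_def h sum_distrib_left by (intro sum.cong refl) (simp only: distrib_left mult_ac)
      then have "Fv (-s, s) - h * F (-s, s) = (\<Sum>m\<le>N. ca m * (signed_wave_dv f f' 1 m (-s, s) - f' 0 * signed_wave f 1 m (-s, s))
          + cb m * (signed_wave_dv f f' (-1) m (-s, s) - f' 0 * signed_wave f (-1) m (-s, s)))"
        unfolding Fv_def by (simp add: right_diff_distrib add_diff_add flip: sum_subtractf)
      also have "\<dots> = (\<Sum>m\<le>N. coeff PP m * (of_nat m * of_real s ^ (m - 1)))"
      proof (intro sum.cong refl)
        fix m
        have "((-1) ^ (m - 1) - (-1) ^ m) * complex_of_real (-2 * s) ^ (m - 1) = 2 ^ m * of_real s ^ (m - 1)"
          if m: "m > 0"
        proof -
          from gr0_implies_Suc[OF m] obtain j where "m = Suc j" ..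
          then show ?thesis by (cases "even j") (simp_all add: power_mult_distrib)
        qed
        then show "ca m * (signed_wave_dv f f' 1 m (-s, s) - f' 0 * signed_wave f 1 m (-s, s))
          + cb m * (signed_wave_dv f f' (-1) m (-s, s) - f' 0 * signed_wave f (-1) m (-s, s)) = coeff PP m * (of_nat m * of_real s ^ (m - 1))"
          unfolding signed_wave_dv_at_0 by (cases "m = 0") (simp_all add: cb_def mult.assoc)
      qed
      finally show ?thesis .
    qed
    define E where "E z = H z - F z" for z
    define Ev where "Ev z = Hv z - Fv z" for z
    have err: "norm (E z) \<le> c / real N ^ (p + 1)" if z: "z \<in> hexagon b" for z
    proof -
      have "norm (E z) \<le> 2 * ((1 + norm h) * (cA / real N ^ Suc p) + 2 * (cP / real N ^ Suc p)) * exp ((2 * Q + 1) * b)"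
      proof (rule cauchy_stability[OF b Q, where Ev = Ev and \<Psi> = "\<lambda>s. \<Psi> s - poly PP (of_real s)"])
        have "hexagon b \<subseteq> square b" by (auto simp: hexagon_def)
        then show "continuous_on (hexagon b) E" unfolding E_def F_def
          by (intro continuous_intros continuous_on_subset[OF cH] continuous_signed_wave)
        fix u v assume uv: "(u, v) \<in> hexagon b"
        then have uvb: "u \<in> {-b..b}" "v \<in> {-b..b}" "u + v \<in> {-b..b}" by (auto simp: hexagon_def)
        show "((\<lambda>w. E (u, w)) has_vector_derivative Ev (u, v)) (at v within {w. (u, w) \<in> hexagon b})"
          unfolding E_def Ev_def F_def Fv_def
          by (intro has_vector_derivative_diff has_vector_derivative_sum has_vector_derivative_add
              has_vector_derivative_mult_right signed_wave_derivative_v[OF uv]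
              has_vector_derivative_within_subset[OF dv[OF uvb(1,2)]]) (auto simp: hexagon_def)
        have "((\<lambda>w. Ev (w, v)) has_vector_derivative q (u + v) * H (u, v)
            - (\<Sum>m\<le>N. ca m * (q (u + v) * signed_wave f 1 m (u, v)) + cb m * (q (u + v) * signed_wave f (-1) m (u, v))))
            (at u within {w. (w, v) \<in> hexagon b})"
          unfolding Ev_def Fv_def qe(2)[OF uvb(3), symmetric]
          by (intro has_vector_derivative_diff has_vector_derivative_sum has_vector_derivative_add
              has_vector_derivative_mult_right signed_wave_dv_derivative_u[OF uv, folded qe(2)[OF uvb(3)]]
              has_vector_derivative_within_subset[OF du[OF uvb(1,2)]]) (auto simp: hexagon_def)
        then show "((\<lambda>w. Ev (w, v)) has_vector_derivative q (u + v) * E (u, v)) (at u within {w. (w, v) \<in> hexagon b})"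
          by (simp add: E_def F_def right_diff_distrib sum_distrib_left algebra_simps)
      next
        fix u assume u: "u \<in> {-b..b}"
        show "norm (E (u, -u)) \<le> cA / real N ^ Suc p" using PA(2)[OF u] by (simp add: E_def F0 A_def)
      next
        fix s assume s: "s \<in> {-b..b}"
        have "((\<lambda>s. complex_of_real s ^ m) has_vector_derivative of_nat m * of_real s ^ (m - 1)) (at s within {-b..b})" for m
          using power_shift_derivative[of 0 1 m s "{-b..b}"] by simp
        then have "((\<lambda>s. \<Psi> s - (\<Sum>m\<le>N. coeff PP m * of_real s ^ m)) has_vector_derivative
            \<psi> s - (\<Sum>m\<le>N. coeff PP m * (of_nat m * of_real s ^ (m - 1)))) (at s within {-b..b})"
          by (intro has_vector_derivative_diff has_vector_derivative_sum has_vector_derivative_mult_right d\<Psi> s)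
        moreover have "\<psi> s - (\<Sum>m\<le>N. coeff PP m * (of_nat m * of_real s ^ (m - 1))) = Ev (-s, s) - h * E (-s, s)"
          unfolding Fv0[symmetric] by (simp add: \<psi>_def Ev_def E_def algebra_simps)
        ultimately show "((\<lambda>s. \<Psi> s - poly PP (of_real s)) has_vector_derivative Ev (-s, s) - h * E (-s, s)) (at s within {-b..b})"
          unfolding poly_sum_upto[OF PP(1)] by simp
        show "norm (\<Psi> s - poly PP (of_real s)) \<le> cP / real N ^ Suc p" by (rule PP(2)[OF s])
      qed (use z in auto)
      also have "\<dots> = c / real N ^ (p + 1)" by (simp add: c_def add_divide_distrib algebra_simps)
      finally show ?thesis .
    qed
    show ?thesis
    proof (intro exI ballI)
      fix x t assume x: "x \<in> {-b..b}" and t: "t \<in> {-b..b}"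
      let ?u = "(x + t) / 2" and ?v = "(x - t) / 2"
      have s: "?u + ?v = x" "?u - ?v = t" by (simp_all add: field_simps)
      have "?u \<in> {-b..b}" "?v \<in> {-b..b}" using x t by auto
      then have dom: "(?u, ?v) \<in> hexagon b" "(?u, ?v) \<in> goursat_domain b"
        unfolding hexagon_def goursat_domain_def mem_Collect_eq prod.case s using x t by blast+
      have "F (?u, ?v) = (\<Sum>m\<in>insert 0 {1..N}. ca m * signed_wave f 1 m (?u, ?v) + cb m * signed_wave f (-1) m (?u, ?v))"
        unfolding F_def by (rule sum.cong) auto
      also have "\<dots> = (ca 0 + cb 0) * wave_poly f 0 x t + (\<Sum>m=1..N. ca m * signed_wave f 1 m (?u, ?v) + cb m * signed_wave f (-1) m (?u, ?v))"
        by (subst sum.insert) (simp_all only: signed_wave_wave_poly(1,2) s distrib_right, auto)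
      also have "(\<Sum>m=1..N. ca m * signed_wave f 1 m (?u, ?v) + cb m * signed_wave f (-1) m (?u, ?v))
         = (\<Sum>m=1..N. (ca m + cb m) * wave_poly f (2 * m - 1) x t + (ca m - cb m) * wave_poly f (2 * m) x t)"
      proof (intro sum.cong refl)
        fix m assume "m \<in> {1..N}"
        then have m: "m \<ge> 1" by simp
        show "ca m * signed_wave f 1 m (?u, ?v) + cb m * signed_wave f (-1) m (?u, ?v)
          = (ca m + cb m) * wave_poly f (2 * m - 1) x t + (ca m - cb m) * wave_poly f (2 * m) x t"
          unfolding signed_wave_wave_poly(3,4)[OF m] s by (simp add: algebra_simps)
      qed
      finally have Fx: "F (?u, ?v) = (ca 0 + cb 0) * wave_poly f 0 x t
           + (\<Sum>n=1..N. (ca n + cb n) * wave_poly f (2 * n - 1) x t)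
           + (\<Sum>n=1..N. (ca n - cb n) * wave_poly f (2 * n) x t)" by (simp add: sum.distrib)
      have "K x t = H (?u, ?v)" using KG[OF x t] GH[OF dom(2)] by simp
      then show "cmod (K x t - ((\<lambda>n. ca n + cb n) 0 * wave_poly f 0 x t
           + (\<Sum>n=1..N. (\<lambda>n. ca n + cb n) n * wave_poly f (2 * n - 1) x t)
           + (\<Sum>n=1..N. (\<lambda>n. ca n - cb n) n * wave_poly f (2 * n) x t))) \<le> c / real N ^ (p + 1)"
        using err[OF dom(1)] unfolding E_def Fx by simp
    qed
  qed
  define approx where "approx = (\<lambda>(\<alpha>, \<beta>) N x t. \<alpha> 0 * wave_poly f 0 x t
           + (\<Sum>n=1..N. \<alpha> n * wave_poly f (2 * n - 1) x t)
           + (\<Sum>n=1..N. \<beta> n * wave_poly f (2 * n) x t))" for N :: nat and x t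
  have "\<exists>ab. N \<ge> 1 \<longrightarrow> (\<forall>x\<in>{- b..b}. \<forall>t\<in>{- b..b}. cmod (K x t - approx ab N x t) \<le> c / real N ^ (p + 1))" for N
  proof (cases "N \<ge> 1")
    case True
    from main[OF this] obtain \<alpha> \<beta> where
      "\<forall>x\<in>{- b..b}. \<forall>t\<in>{- b..b}. cmod (K x t - approx (\<alpha>, \<beta>) N x t) \<le> c / real N ^ (p + 1)"
      unfolding approx_def prod.case by blast
    then show ?thesis by blast
  qed simp
  then obtain ab where ab: "\<And>N. N \<ge> 1 \<Longrightarrow>
      \<forall>x\<in>{- b..b}. \<forall>t\<in>{- b..b}. cmod (K x t - approx (ab N) N x t) \<le> c / real N ^ (p + 1)"
    using choice[of "\<lambda>N ab. N \<ge> 1 \<longrightarrow> (\<forall>x\<in>{- b..b}. \<forall>t\<in>{- b..b}. cmod (K x t - approx ab N x t) \<le> c / real N ^ (p + 1))"]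
    by blast
  show ?thesis
  proof (intro exI allI impI conjI)
    fix N :: nat assume N: "1 \<le> N"
    show "\<forall>x\<in>{- b..b}. \<forall>t\<in>{- b..b}. (\<lambda>N. approx (ab N) N) N x t = fst (ab N) 0 * wave_poly f 0 x t
           + (\<Sum>n=1..N. fst (ab N) n * wave_poly f (2 * n - 1) x t)
           + (\<Sum>n=1..N. snd (ab N) n * wave_poly f (2 * n) x t)"
      by (simp add: approx_def case_prod_unfold)
    show "\<forall>x\<in>{- b..b}. \<forall>t\<in>{- b..b}. cmod (K x t - (\<lambda>N. approx (ab N) N) N x t) \<le> c / real N ^ (p + 1)"
      by (rule ab[OF N])
  qed
qed

end
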